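(* Let $0<a_1\le a_2$ be fixed constants. There is a constant $C>0$ depending only on $a_1,a_2$ such that the following holds. Let $\Omega_i=\mathbb R^p$ for all $i$, let $\mathcal G$ be a connected simple undirected graph on $n$ agents, and let each $f_i$ have $L_i$-Lipschitz gradient and be $\mu_i$-strongly convex ($\mu_i>0$); set $\mu=\min_i\mu_i$, $L=\max_iL_i$, $\kappa_{\mathbf f}=L/\mu$. Let $\mathbf L=0.5(I-W)$, where $W$ is the lazy Metropolis matrix of $\mathcal G$, and choose the parameters of Mirror-P-EXTRA as $c=\Theta(n\mu^{-0.5}L^{-0.5})$, i.e. $a_1n\mu^{-0.5}L^{-0.5}\le c\le a_2n\mu^{-0.5}L^{-0.5}$, and $B=\beta I$ with $\beta=c$. Then the number of iterations needed to reach $\varepsilon$-accuracy is $O\big((n^2+n\kappa_{\mathbf f}^{0.5})\ln(\varepsilon^{-1})\big)$, i.e. for every $\varepsilon\in(0,1)$ and every integer $k\ge C(n^2+n\kappa_{\mathbf f}^{0.5})\ln(\varepsilon^{-1})$, $$\|\mathbf z^k-\mathbf z^*\|_{\mathcal M}^2\le\varepsilon\,\|\mathbf z^0-\mathbf z^*\|_{\mathcal M}^2 .$$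
   Context: Problem. There are $n$ agents; agent $i$ has $f_i:\mathbb R^p\to\mathbb R$ and $r_i\in\mathbb R^p$. The (unconstrained, $\Omega_i=\mathbb R^p$) resource allocation problem is: minimize $\mathbf f(\mathbf x)=\sum_{i=1}^n f_i(x_i)$ subject to $\sum_{i=1}^n(x_i-r_i)=0$. Points are matrices $\mathbf x\in\mathbb R^{n\times p}$ with $i$-th row $x_i^\top$; $\mathbf r$ has rows $r_i^\top$; $\nabla\mathbf f(\mathbf x)$ is the matrix with rows $(\nabla f_i(x_i))^\top$. A function $f$ is $\mu$-strongly convex if $\langle \nabla f(x)-\nabla f(y),x-y\rangle\ge\mu\|x-y\|_2^2$ for all $x,y$. Graph. $\mathcal G$ has vertex set $\{1,\dots,n\}$, edge set $\mathcal E$ and neighbor sets $\mathcal N_i$. The lazy Metropolis matrix $W$ is: $W_{ij}=1/(2\max\{|\mathcal N_i|,|\mathcal N_j|\})$ if $\{i,j\}\in\mathcal E$; $W_{ij}=0$ if $\{i,j\}\notin\mathcal E$ and $i\ne j$; $W_{ii}=1-\sum_{l\in\mathcal N_i}W_{il}$. Write $\mathbf L=0.5(I-W)=[L_{ij}]=U^\top U$ with $U\in\mathbb R^{(n-1)\times n}$ of full row rank and null space $\{a\mathbf 1:a\in\mathbb R\}$. Algorithm (Mirror-P-EXTRA, with $\Omega_i=\mathbb R^p$). Each agent $i$ has $\beta_i>0$; all share $c>0$; $B=\mathrm{diag}(\beta_1,\dots,\beta_n)$. Initialize $x_i^0\in\mathbb R^p$, $s_i^0=\nabla f_i(x_i^0)$,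 $y_i^{-1}=0$. For $k=0,1,\dots$: $y_i^k=y_i^{k-1}+\sum_{j\in\mathcal N_i\cup\{i\}}L_{ij}s_j^k$; $x_i^{k+1}=\arg\min_{x_i\in\mathbb R^p}\{f_i(x_i)-\langle s_i^k,x_i\rangle+\frac1{2\beta_i}\|x_i-r_i+2cy_i^k-cy_i^{k-1}\|_2^2\}$; $s_i^{k+1}=s_i^k-\frac1{\beta_i}(x_i^{k+1}-r_i+2cy_i^k-cy_i^{k-1})$. Define $\mathbf q^{-1}=0$, $\mathbf q^{k}=\mathbf q^{k-1}+U\nabla\mathbf f(\mathbf x^k)$ for $k\ge0$, and $$\mathcal M=\begin{pmatrix}cI&0\\0&B-c\mathbf L\end{pmatrix},\quad \mathbf z^k=\begin{pmatrix}\mathbf q^k\\ \nabla\mathbf f(\mathbf x^k)\end{pmatrix},\quad \mathbf z^*=\begin{pmatrix}\mathbf q^*\\ \nabla\mathbf f(\mathbf x^* )\end{pmatrix},$$ where $\mathbf x^*$ is the optimal solution and $\mathbf q^*\in\mathbb R^{(n-1)\times p}$ satisfies $\mathbf x^*-\mathbf r+cU^\top\mathbf q^*=0$. $\|A\|_{\mathcal M}=\sqrt{\mathrm{Trace}(A^\top\mathcal MA)}$. *)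

theory Defs
  imports Complex_Main
    "Jordan_Normal_Form.DL_Rank"
    "Jordan_Normal_Form.Matrix_Kernel"
    "Graph_Theory.Graph_Theory"
begin

text \<open>
  The constant of the main statement must not depend on the number \<open>n\<close> of agents nor on the
  dimension \<open>p\<close>, so neither can be encoded as a type. We use \<^typ>\<open>real vec\<close> and
  \<^typ>\<open>real mat\<close> with explicit carriers; agents are \<open>0, ..., n - 1\<close>. A function on
  \<open>R^p\<close> is a function on \<^typ>\<open>real vec\<close> of which only the values on
  \<^term>\<open>carrier_vec p\<close> matter.
\<close>

subsection \<open>Gradients on \<open>R^p\<close>\<close>

definition vnorm :: "real vec \<Rightarrow> real" where
  "vnorm v = sqrt (v \<bullet> v)"

text \<open>\<^typ>\<open>real vec\<close> is not a normed space, so Frechet differentiability is spelled out.\<close>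

definition has_gradient :: "nat \<Rightarrow> (real vec \<Rightarrow> real) \<Rightarrow> real vec \<Rightarrow> real vec \<Rightarrow> bool" where
  "has_gradient p f g x \<longleftrightarrow> g \<in> carrier_vec p \<and>
     (\<forall>e>0. \<exists>d>0. \<forall>y\<in>carrier_vec p. vnorm (y - x) < d \<longrightarrow>
        \<bar>f y - f x - g \<bullet> (y - x)\<bar> \<le> e * vnorm (y - x))"

definition gradient :: "nat \<Rightarrow> (real vec \<Rightarrow> real) \<Rightarrow> real vec \<Rightarrow> real vec" where
  "gradient p f x = (THE g. has_gradient p f g x)"

definition differentiable_vec :: "nat \<Rightarrow> (real vec \<Rightarrow> real) \<Rightarrow> bool" where
  "differentiable_vec p f \<longleftrightarrow> (\<forall>x\<in>carrier_vec p. \<exists>g. has_gradient p f g x)"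

definition lipschitz_gradient :: "nat \<Rightarrow> real \<Rightarrow> (real vec \<Rightarrow> real) \<Rightarrow> bool" where
  "lipschitz_gradient p l f \<longleftrightarrow> differentiable_vec p f \<and>
     (\<forall>x\<in>carrier_vec p. \<forall>y\<in>carrier_vec p.
        vnorm (gradient p f x - gradient p f y) \<le> l * vnorm (x - y))"

definition strongly_convex :: "nat \<Rightarrow> real \<Rightarrow> (real vec \<Rightarrow> real) \<Rightarrow> bool" where
  "strongly_convex p m f \<longleftrightarrow> differentiable_vec p f \<and>
     (\<forall>x\<in>carrier_vec p. \<forall>y\<in>carrier_vec p.
        (gradient p f x - gradient p f y) \<bullet> (x - y) \<ge> m * (vnorm (x - y))\<^sup>2)"

lemma has_gradient_unique:
  assumes x: "x \<in> carrier_vec p" and g: "has_gradient p f g x" and h: "has_gradient p f h x"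
  shows "g = h"
proof (rule ccontr)
  assume ne: "g \<noteq> h"
  have gc: "g \<in> carrier_vec p" and hc: "h \<in> carrier_vec p"
    using g h by (auto simp: has_gradient_def)
  define v where "v = g - h"
  have v: "v \<in> carrier_vec p" using gc hc by (simp add: v_def)
  have dims: "dim_vec g = p" "dim_vec h = p" "dim_vec v = p" using gc hc v by auto
  have "\<exists>i<p. g $ i \<noteq> h $ i" using ne dims by (metis eq_vecI)
  then obtain i where i: "i < p" "v $ i \<noteq> 0" using dims by (auto simp: v_def)
  have vv: "v \<bullet> v > 0"
    unfolding scalar_prod_def
  proof (rule sum_pos2)
    show "i \<in> {0..<dim_vec v}" "0 < v $ i * v $ i" using i dims
      by (auto simp: zero_less_mult_iff linorder_neq_iff)
  qed auto
  define N where "N = vnorm v"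
  have N: "N > 0" "v \<bullet> v = N * N" using vv by (auto simp: N_def vnorm_def)
  obtain d1 where d1: "d1 > 0" "\<And>y. y \<in> carrier_vec p \<Longrightarrow> vnorm (y - x) < d1 \<Longrightarrow>
      \<bar>f y - f x - g \<bullet> (y - x)\<bar> \<le> N/3 * vnorm (y - x)"
    using g N unfolding has_gradient_def by (metis divide_pos_pos zero_less_numeral)
  obtain d2 where d2: "d2 > 0" "\<And>y. y \<in> carrier_vec p \<Longrightarrow> vnorm (y - x) < d2 \<Longrightarrow>
      \<bar>f y - f x - h \<bullet> (y - x)\<bar> \<le> N/3 * vnorm (y - x)"
    using h N unfolding has_gradient_def by (metis divide_pos_pos zero_less_numeral)
  define t where "t = min d1 d2 / (2 * N)"
  have t: "t > 0" using d1(1) d2(1) N by (simp add: t_def)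
  define y where "y = x + t \<cdot>\<^sub>v v"
  have y: "y \<in> carrier_vec p" using x v by (simp add: y_def)
  have yx: "y - x = t \<cdot>\<^sub>v v" using x v by (auto simp: y_def)
  have nyx: "vnorm (y - x) = t * N"
  proof -
    have "(t \<cdot>\<^sub>v v) \<bullet> (t \<cdot>\<^sub>v v) = (t * N)\<^sup>2"
      using v N(2) by (simp add: power2_eq_square)
    then show ?thesis unfolding yx vnorm_def using t N(1) by simp
  qed
  have "t * N = min d1 d2 / 2" using N by (simp add: t_def)
  then have "t * N < d1" "t * N < d2" using d1(1) d2(1) unfolding min_def by (auto split: if_splits)
  then have "\<bar>f y - f x - g \<bullet> (y - x)\<bar> \<le> N/3 * (t * N)" "\<bar>f y - f x - h \<bullet> (y - x)\<bar> \<le> N/3 * (t * N)"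
    using d1(2)[OF y] d2(2)[OF y] nyx by auto
  moreover have "g \<bullet> (y - x) - h \<bullet> (y - x) = t * (N * N)"
  proof -
    have "g \<bullet> (y - x) - h \<bullet> (y - x) = (g - h) \<bullet> (t \<cdot>\<^sub>v v)"
      unfolding yx using gc hc v by (simp add: minus_scalar_prod_distrib[of _ p] right_diff_distrib)
    also have "\<dots> = t * (v \<bullet> v)" unfolding v_def[symmetric] using v by simp
    finally show ?thesis using N(2) by simp
  qed
  moreover have "N/3 * (t * N) = t * (N * N) / 3" by (simp add: field_simps)
  ultimately have "t * (N * N) \<le> 2 * (t * (N * N) / 3)" unfolding abs_le_iff by linarith
  moreover have "t * (N * N) > 0" using t N by simp
  ultimately show False by linarith
qed

lemma gradient_eq:
  "x \<in> carrier_vec p \<Longrightarrow> has_gradient p f g x \<Longrightarrow> gradient p f x = g"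
  unfolding gradient_def using has_gradient_unique by blast

subsection \<open>Resource allocation\<close>

definition total_cost :: "nat \<Rightarrow> (nat \<Rightarrow> real vec \<Rightarrow> real) \<Rightarrow> real mat \<Rightarrow> real" where
  "total_cost n f X = (\<Sum>i<n. f i (row X i))"

definition stacked_gradient ::
    "nat \<Rightarrow> nat \<Rightarrow> (nat \<Rightarrow> real vec \<Rightarrow> real) \<Rightarrow> real mat \<Rightarrow> real mat" where
  "stacked_gradient n p f X = mat_of_rows p (map (\<lambda>i. gradient p (f i) (row X i)) [0..<n])"

definition feasible :: "nat \<Rightarrow> nat \<Rightarrow> real mat \<Rightarrow> real mat \<Rightarrow> bool" where
  "feasible n p R X \<longleftrightarrow> X \<in> carrier_mat n p \<and>
     finsum_vec TYPE(real) p (\<lambda>i. row X i - row R i) {..<n} = 0\<^sub>v p"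

definition optimal_allocation ::
    "nat \<Rightarrow> nat \<Rightarrow> (nat \<Rightarrow> real vec \<Rightarrow> real) \<Rightarrow> real mat \<Rightarrow> real mat \<Rightarrow> bool" where
  "optimal_allocation n p f R X \<longleftrightarrow> is_arg_min (total_cost n f) (feasible n p R) X"

subsection \<open>The lazy Metropolis matrix\<close>

text \<open>
  A simple undirected graph is a \<^locale>\<open>pair_graph\<close>: finite, loop-free, with symmetric
  arc relation.
\<close>

definition neighbors :: "nat pair_pre_digraph \<Rightarrow> nat \<Rightarrow> nat set" where
  "neighbors G i = {j. (i, j) \<in> parcs G}"

definition metropolis_weight :: "nat pair_pre_digraph \<Rightarrow> nat \<Rightarrow> nat \<Rightarrow> real" where
  "metropolis_weight G i j = 1 / (2 * real (max (card (neighbors G i)) (card (neighbors G j))))"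

definition lazy_metropolis :: "nat \<Rightarrow> nat pair_pre_digraph \<Rightarrow> real mat" where
  "lazy_metropolis n G = mat n n (\<lambda>(i, j).
     if i = j then 1 - (\<Sum>l\<in>neighbors G i. metropolis_weight G i l)
     else if (i, j) \<in> parcs G then metropolis_weight G i j
     else 0)"

definition metropolis_laplacian :: "nat \<Rightarrow> nat pair_pre_digraph \<Rightarrow> real mat" where
  "metropolis_laplacian n G = (1/2) \<cdot>\<^sub>m (1\<^sub>m n - lazy_metropolis n G)"

definition laplacian_factor :: "nat \<Rightarrow> real mat \<Rightarrow> real mat \<Rightarrow> bool" where
  "laplacian_factor n A U \<longleftrightarrow> U \<in> carrier_mat (n - 1) n \<and> A = U\<^sup>T * U \<and>
     vec_space.rank (n - 1) U = n - 1 \<and>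
     mat_kernel U = {a \<cdot>\<^sub>v vec n (\<lambda>_. 1) | a. True}"

subsection \<open>Mirror-P-EXTRA\<close>

text \<open>
  The sequences \<open>y\<close> and \<open>q\<close> start at index \<open>-1\<close>; we shift them by one: \<open>Y k\<close> stands for
  \<open>y^(k-1)\<close> and \<open>mirror_q n p U g k\<close> for \<open>q^(k-1)\<close>.
\<close>

definition mirror_p_extra ::
    "nat \<Rightarrow> nat \<Rightarrow> nat pair_pre_digraph \<Rightarrow> real mat \<Rightarrow> (nat \<Rightarrow> real vec \<Rightarrow> real) \<Rightarrow> real mat \<Rightarrow>
     (nat \<Rightarrow> real) \<Rightarrow> real \<Rightarrow> (nat \<Rightarrow> real mat) \<Rightarrow> (nat \<Rightarrow> real mat) \<Rightarrow> (nat \<Rightarrow> real mat) \<Rightarrow> bool" where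
  "mirror_p_extra n p G Lap f R \<beta> c X S Y \<longleftrightarrow>
     (\<forall>k. X k \<in> carrier_mat n p \<and> S k \<in> carrier_mat n p \<and> Y k \<in> carrier_mat n p) \<and>
     (\<forall>i<n. row (S 0) i = gradient p (f i) (row (X 0) i) \<and> row (Y 0) i = 0\<^sub>v p) \<and>
     (\<forall>k. \<forall>i<n.
        let shift = - row R i + (2 * c) \<cdot>\<^sub>v row (Y (Suc k)) i - c \<cdot>\<^sub>v row (Y k) i in
        row (Y (Suc k)) i = row (Y k) i +
          finsum_vec TYPE(real) p (\<lambda>j. Lap $$ (i, j) \<cdot>\<^sub>v row (S k) j) (insert i (neighbors G i)) \<and>
        is_arg_min
          (\<lambda>v. f i v - row (S k) i \<bullet> v + 1 / (2 * \<beta> i) * (vnorm (v + shift))\<^sup>2)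
          (\<lambda>v. v \<in> carrier_vec p) (row (X (Suc k)) i) \<and>
        row (S (Suc k)) i = row (S k) i - (1 / \<beta> i) \<cdot>\<^sub>v (row (X (Suc k)) i + shift))"

primrec mirror_q :: "nat \<Rightarrow> nat \<Rightarrow> real mat \<Rightarrow> (nat \<Rightarrow> real mat) \<Rightarrow> nat \<Rightarrow> real mat" where
  "mirror_q n p U g 0 = 0\<^sub>m (n - 1) p"
| "mirror_q n p U g (Suc k) = mirror_q n p U g k + U * g k"

definition mirror_z ::
    "nat \<Rightarrow> nat \<Rightarrow> real mat \<Rightarrow> (nat \<Rightarrow> real vec \<Rightarrow> real) \<Rightarrow> (nat \<Rightarrow> real mat) \<Rightarrow> nat \<Rightarrow> real mat" where
  "mirror_z n p U f X k =
     mirror_q n p U (\<lambda>t. stacked_gradient n p f (X t)) (Suc k) @\<^sub>r stacked_gradient n p f (X k)"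

definition mirror_M :: "nat \<Rightarrow> real mat \<Rightarrow> (nat \<Rightarrow> real) \<Rightarrow> real \<Rightarrow> real mat" where
  "mirror_M n Lap \<beta> c = four_block_mat
     (c \<cdot>\<^sub>m 1\<^sub>m (n - 1)) (0\<^sub>m (n - 1) n)
     (0\<^sub>m n (n - 1)) (mat_diag n \<beta> - c \<cdot>\<^sub>m Lap)"

definition mat_trace :: "real mat \<Rightarrow> real" where
  "mat_trace A = (\<Sum>i<dim_row A. A $$ (i, i))"

definition mat_norm :: "real mat \<Rightarrow> real mat \<Rightarrow> real" where
  "mat_norm M A = sqrt (mat_trace (A\<^sup>T * M * A))"

end

theory Submission
  imports Defs "HOL-Analysis.L2_Norm"
begin

text \<open>
  The method is a proximal point iteration in disguise. Write \<open>g = \<nabla>\<^bold>f(x)\<close> for the stacked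
  gradients. The optimality condition of the local minimisation says \<open>s\<^sup>k = g\<^sup>k\<close>
  (\<open>S_eq_grads\<close>), the consensus step says \<open>y\<^sup>k = U\<^sup>T q\<^sup>k\<close> (\<open>Y_eq_dual\<close>), and at the optimum
  all local gradients agree, so that \<open>U g\<^sup>* = 0\<close> because the kernel of \<open>U\<close> is spanned by the
  constant vectors (\<open>optimal_allocation_equal_gradients\<close>, \<open>factor_mult_equal_rows\<close>). With the
  errors \<open>Q = q - q\<^sup>*\<close>, \<open>A = g - g\<^sup>*\<close>, \<open>E = x - x\<^sup>*\<close> after a step and \<open>D\<close> the increment of \<open>g\<close>
  in that step, these facts combine to
  \<open>E = - c (U\<^sup>T Q + (I - U\<^sup>T U) D)\<close> (\<open>error_recursion\<close>), while the errors before the step are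
  \<open>Q - U A\<close> and \<open>A - D\<close>.

  The squared \<open>M\<close>-norm of the error is \<open>V(Q, A) = c |Q|\<^sup>2 + c (|A|\<^sup>2 - |U A|\<^sup>2)\<close>, and expanding the
  square gives the exact balance
  \<open>V(Q - U A, A - D) = V(Q, A) + V(U A, D) + 2 \<langle>A, E\<rangle>\<close> (\<open>lyapunov_step_identity\<close>). Linear
  convergence follows once the decrease \<open>V(U A, D) + 2 \<langle>A, E\<rangle>\<close> is at least \<open>V(Q, A) / T\<close>
  (\<open>lyapunov_contraction\<close>). Three inequalities give this.

  \<^item> Cocoercivity \<open>|A|\<^sup>2 \<le> L \<langle>A, E\<rangle>\<close> (\<open>gradient_cocoercive\<close>) controls the gradient part of \<open>V\<close>,
    at the price \<open>c L\<close>. Lipschitz continuity and strong convexity alone would cost a further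
    factor \<open>\<kappa>\<close> here.

  \<^item> Strong convexity \<open>\<mu> |E|\<^sup>2 \<le> \<langle>A, E\<rangle>\<close> and \<open>|(I - U\<^sup>T U) D|\<^sup>2 \<le> |D|\<^sup>2 - |U D|\<^sup>2\<close> control the size of
    \<open>U\<^sup>T Q\<close> through the recursion.

  \<^item> The spectral gap \<open>|Q|\<^sup>2 \<le> 48 n\<^sup>2 |U\<^sup>T Q|\<^sup>2\<close> (\<open>factor_transpose_lower_bound\<close>) turns this into
    control of \<open>Q\<close>. It rests on the fact that the degrees along a shortest path add up to at most
    \<open>3 n\<close> (\<open>geodesic_degree_sum\<close>): Cauchy-Schwarz along such a path bounds \<open>(v\<^sub>s - v\<^sub>t)\<^sup>2\<close> by
    \<open>6 n\<close> times the sum of \<open>(v\<^sub>i - v\<^sub>j)\<^sup>2 / max d\<^sub>i d\<^sub>j\<close> over the arcs, with \<open>d\<close> the degrees, and these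
    summands are those of the Laplacian form up to a constant.

  Altogether \<open>T\<close> may be any bound for \<open>96 n\<^sup>2\<close> and for half of \<open>c L + 96 n\<^sup>2 / (c \<mu>)\<close>. The choice
  \<open>c = \<Theta>(n / sqrt (\<mu> L))\<close> balances the last two summands, making both of order \<open>n sqrt \<kappa>\<close>.
\<close>

section \<open>Euclidean vectors and the Frobenius inner product\<close>

lemma Cauchy_Schwarz_sum:
  fixes a b :: "'a \<Rightarrow> real"
  shows "(\<Sum>i\<in>A. a i * b i)\<^sup>2 \<le> (\<Sum>i\<in>A. (a i)\<^sup>2) * (\<Sum>i\<in>A. (b i)\<^sup>2)"
proof -
  have "\<bar>\<Sum>i\<in>A. a i * b i\<bar> \<le> (\<Sum>i\<in>A. \<bar>a i\<bar> * \<bar>b i\<bar>)"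
    by (rule order_trans[OF sum_abs]) (simp add: abs_mult)
  also have "\<dots> \<le> L2_set a A * L2_set b A" by (rule L2_set_mult_ineq)
  finally have "\<bar>\<Sum>i\<in>A. a i * b i\<bar>\<^sup>2 \<le> (L2_set a A * L2_set b A)\<^sup>2"
    by (rule power_mono) simp
  then show ?thesis
    by (simp add: L2_set_def power_mult_distrib sum_nonneg)
qed

lemma scalar_prod_self: "v \<bullet> v = (\<Sum>i<dim_vec v. (v $ i)\<^sup>2)" for v :: "real vec"
  by (simp add: scalar_prod_def power2_eq_square atLeast0LessThan)

lemma scalar_prod_self_nonneg [simp]: "0 \<le> v \<bullet> v" for v :: "real vec"
  by (simp add: scalar_prod_self sum_nonneg)

lemma scalar_prod_self_eq_0:
  fixes v :: "real vec"
  assumes "v \<in> carrier_vec p" "v \<bullet> v = 0"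
  shows "v = 0\<^sub>v p"
  using assms by (intro eq_vecI) (auto simp: scalar_prod_self sum_nonneg_eq_0_iff)

lemma vnorm_nonneg [simp]: "0 \<le> vnorm v"
  by (simp add: vnorm_def)

lemma vnorm_power2: "(vnorm v)\<^sup>2 = v \<bullet> v"
  by (simp add: vnorm_def)

lemma vnorm_smult: "vnorm (a \<cdot>\<^sub>v v) = \<bar>a\<bar> * vnorm v"
proof -
  have "(a \<cdot>\<^sub>v v) \<bullet> (a \<cdot>\<^sub>v v) = a\<^sup>2 * (v \<bullet> v)"
    by (simp add: power2_eq_square)
  then show ?thesis by (simp add: vnorm_def real_sqrt_mult)
qed

lemma Cauchy_Schwarz_vec:
  fixes v w :: "real vec"
  assumes "dim_vec v = dim_vec w"
  shows "(v \<bullet> w)\<^sup>2 \<le> (v \<bullet> v) * (w \<bullet> w)"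
  using Cauchy_Schwarz_sum[of "vec_index v" "vec_index w" "{..<dim_vec w}"] assms
  by (simp add: scalar_prod_self) (simp add: scalar_prod_def atLeast0LessThan)

lemma scalar_prod_le_vnorm:
  assumes "dim_vec v = dim_vec w"
  shows "v \<bullet> w \<le> vnorm v * vnorm w"
proof -
  have "\<bar>v \<bullet> w\<bar> \<le> sqrt ((v \<bullet> v) * (w \<bullet> w))"
    using Cauchy_Schwarz_vec[OF assms] by (metis real_sqrt_abs real_sqrt_le_mono)
  then show ?thesis by (simp add: vnorm_def real_sqrt_mult)
qed

text \<open>
  The inner product for which \<open>mat_trace (A\<^sup>T * B)\<close> is the value, written entrywise so that it is
  bilinear under bare dimension conditions and splits along rows (agents) as well as along columns
  (coordinates of \<open>R^p\<close>).
\<close>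

definition frob :: "real mat \<Rightarrow> real mat \<Rightarrow> real" where
  "frob A B = (\<Sum>i<dim_row A. \<Sum>j<dim_col A. A $$ (i, j) * B $$ (i, j))"

lemma frob_rows:
  assumes "A \<in> carrier_mat n p" "B \<in> carrier_mat n p"
  shows "frob A B = (\<Sum>i<n. row A i \<bullet> row B i)"
  using assms by (auto simp: frob_def scalar_prod_def atLeast0LessThan intro!: sum.cong)

lemma frob_cols:
  assumes "A \<in> carrier_mat n p" "B \<in> carrier_mat n p"
  shows "frob A B = (\<Sum>j<p. col A j \<bullet> col B j)"
proof -
  have "frob A B = (\<Sum>j<p. \<Sum>i<n. A $$ (i, j) * B $$ (i, j))"
    using assms by (simp add: frob_def sum.swap[of _ "{..<n}"])
  then show ?thesis
    using assms by (auto simp: scalar_prod_def atLeast0LessThan intro!: sum.cong)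
qed

lemma frob_commute:
  "dim_row A = dim_row B \<Longrightarrow> dim_col A = dim_col B \<Longrightarrow> frob A B = frob B A"
  by (simp add: frob_def mult.commute)

lemma frob_self_nonneg [simp]: "0 \<le> frob A A"
  by (simp add: frob_def sum_nonneg)

lemma frob_left:
  assumes "dim_row A = dim_row B" "dim_col A = dim_col B"
  shows frob_add_left: "frob (A + B) C = frob A C + frob B C"
    and frob_minus_left: "frob (A - B) C = frob A C - frob B C"
  using assms by (simp_all add: frob_def algebra_simps sum.distrib sum_subtractf)

lemma frob_smult_left: "frob (a \<cdot>\<^sub>m A) C = a * frob A C"
  by (simp add: frob_def sum_distrib_left mult.assoc)

lemma frob_right:
  assumes "dim_row A = dim_row B" "dim_col A = dim_col B"
    "dim_row A = dim_row C" "dim_col A = dim_col C"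
  shows frob_add_right: "frob A (B + C) = frob A B + frob A C"
    and frob_minus_right: "frob A (B - C) = frob A B - frob A C"
  using assms by (simp_all add: frob_def algebra_simps sum.distrib sum_subtractf)

lemma frob_smult_right:
  assumes "dim_row A = dim_row B" "dim_col A = dim_col B"
  shows "frob A (a \<cdot>\<^sub>m B) = a * frob A B"
  using assms by (simp add: frob_def sum_distrib_left mult.left_commute)

lemma frob_mult_left:
  assumes "dim_col U = dim_row A" "dim_row U = dim_row B" "dim_col A = dim_col B"
  shows "frob (U * A) B = frob A (U\<^sup>T * B)"
proof -
  define m n p where "m = dim_row B" and "n = dim_row A" and "p = dim_col B"
  have U: "U \<in> carrier_mat m n" and A: "A \<in> carrier_mat n p" and B: "B \<in> carrier_mat m p"
    using assms by (auto simp: m_def n_def p_def)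
  have "(U *\<^sub>v col A j) \<bullet> col B j = col A j \<bullet> (U\<^sup>T *\<^sub>v col B j)" if "j < p" for j
  proof -
    have "(U *\<^sub>v col A j) \<bullet> col B j = col B j \<bullet> (U *\<^sub>v col A j)"
      using U A B by (intro comm_scalar_prod[of _ m]) auto
    also have "\<dots> = (U\<^sup>T *\<^sub>v col B j) \<bullet> col A j"
      using U A B by (metis col_carrier_vec transpose_vec_mult_scalar \<open>j < p\<close>)
    also have "\<dots> = col A j \<bullet> (U\<^sup>T *\<^sub>v col B j)"
      using U A B by (intro comm_scalar_prod[of _ n]) auto
    finally show ?thesis .
  qed
  moreover have "frob (U * A) B = (\<Sum>j<p. (U *\<^sub>v col A j) \<bullet> col B j)"
    using U A B by (simp add: frob_cols[of _ m p] del: col_mult)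
  moreover have "frob A (U\<^sup>T * B) = (\<Sum>j<p. col A j \<bullet> (U\<^sup>T *\<^sub>v col B j))"
    using U A B by (simp add: frob_cols[of _ n p] del: col_mult)
  ultimately show ?thesis by simp
qed

lemma mat_trace_transpose_mult:
  assumes "A \<in> carrier_mat n p" "B \<in> carrier_mat n p"
  shows "mat_trace (A\<^sup>T * B) = frob A B"
  using assms by (simp add: mat_trace_def frob_cols[OF assms])

section \<open>Smooth strongly convex functions\<close>

lemma has_gradient_gradient:
  assumes "differentiable_vec p f" "x \<in> carrier_vec p"
  shows "has_gradient p f (gradient p f x) x"
  using assms gradient_eq unfolding differentiable_vec_def by metis

lemma gradient_carrier:
  assumes "differentiable_vec p f" "x \<in> carrier_vec p"
  shows "gradient p f x \<in> carrier_vec p"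
  using has_gradient_gradient[OF assms] by (simp add: has_gradient_def)

text \<open>
  Reduces statements on \<open>R^p\<close> to one-variable calculus: the mean value theorem and Fermat's
  criterion are only applied to restrictions to lines.
\<close>

lemma has_gradient_along_line:
  assumes x: "x \<in> carrier_vec p" and v: "v \<in> carrier_vec p"
    and g: "has_gradient p f g (x + t \<cdot>\<^sub>v v)"
  shows "((\<lambda>t. f (x + t \<cdot>\<^sub>v v)) has_real_derivative g \<bullet> v) (at t)"
  unfolding DERIV_def
proof (rule LIM_I)
  fix e :: real assume e: "e > 0"
  define N where "N = vnorm v"
  have N: "N \<ge> 0" by (simp add: N_def)
  \<comment> \<open>\<open>N + 1\<close> instead of \<open>N\<close> because the direction may be zero.\<close>
  define e' where "e' = e / (N + 1)"
  have e': "e' > 0" "e' * N < e"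
    using e N by (simp_all add: e'_def field_simps)
  have gc: "g \<in> carrier_vec p" using g by (simp add: has_gradient_def)
  from g e'(1) obtain d where d: "d > 0"
    "\<And>y. y \<in> carrier_vec p \<Longrightarrow> vnorm (y - (x + t \<cdot>\<^sub>v v)) < d \<Longrightarrow>
       \<bar>f y - f (x + t \<cdot>\<^sub>v v) - g \<bullet> (y - (x + t \<cdot>\<^sub>v v))\<bar> \<le> e' * vnorm (y - (x + t \<cdot>\<^sub>v v))"
    unfolding has_gradient_def by metis
  show "\<exists>s>0. \<forall>h. h \<noteq> 0 \<and> norm (h - 0) < s \<longrightarrow>
     norm ((f (x + (t + h) \<cdot>\<^sub>v v) - f (x + t \<cdot>\<^sub>v v)) / h - g \<bullet> v) < e"
  proof (intro exI conjI allI impI)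
    show "d / (N + 1) > 0" using d N by simp
    fix h :: real assume h: "h \<noteq> 0 \<and> norm (h - 0) < d / (N + 1)"
    define D where "D = f (x + (t + h) \<cdot>\<^sub>v v) - f (x + t \<cdot>\<^sub>v v)"
    have diff: "x + (t + h) \<cdot>\<^sub>v v - (x + t \<cdot>\<^sub>v v) = h \<cdot>\<^sub>v v"
      using x v by (intro eq_vecI) (auto simp: algebra_simps)
    have "\<bar>h\<bar> * (N + 1) < d" using h N by (simp add: field_simps)
    then have small: "\<bar>h\<bar> * N < d" by (simp add: algebra_simps)
    have "\<bar>D - h * (g \<bullet> v)\<bar> \<le> e' * (\<bar>h\<bar> * N)"
      using d(2)[of "x + (t + h) \<cdot>\<^sub>v v"] x v gc small
      by (simp add: diff vnorm_smult D_def N_def)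
    also have "\<dots> < \<bar>h\<bar> * e" using e'(2) h by simp
    finally have "\<bar>D - h * (g \<bullet> v)\<bar> / \<bar>h\<bar> < e" using h by (simp add: field_simps)
    moreover have "D / h - g \<bullet> v = (D - h * (g \<bullet> v)) / h" using h by (simp add: field_simps)
    ultimately show "norm ((f (x + (t + h) \<cdot>\<^sub>v v) - f (x + t \<cdot>\<^sub>v v)) / h - g \<bullet> v) < e"
      by (simp add: D_def)
  qed
qed

lemma add_zero_smult_vec:
  fixes x :: "real vec"
  assumes "x \<in> carrier_vec p" "v \<in> carrier_vec p"
  shows "x + 0 \<cdot>\<^sub>v v = x"
  using assms by (intro eq_vecI) auto

lemma gradient_along_segment:
  assumes "differentiable_vec p f" "x \<in> carrier_vec p" "v \<in> carrier_vec p"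
  shows "((\<lambda>t. f (x + t \<cdot>\<^sub>v v)) has_real_derivative gradient p f (x + t \<cdot>\<^sub>v v) \<bullet> v) (at t)"
  using assms has_gradient_gradient[of p f "x + t \<cdot>\<^sub>v v"]
  by (intro has_gradient_along_line) auto

text \<open>
  Along the segment from \<open>x\<close> to \<open>y\<close> the function minus its tangent at \<open>x\<close> has nonnegative
  derivative, by monotonicity of the gradient.
\<close>

lemma convex_above_tangent:
  assumes diff: "differentiable_vec p f" and x: "x \<in> carrier_vec p" and y: "y \<in> carrier_vec p"
    and mono: "\<And>x y. x \<in> carrier_vec p \<Longrightarrow> y \<in> carrier_vec p \<Longrightarrow>
      0 \<le> (gradient p f x - gradient p f y) \<bullet> (x - y)"
  shows "f x + gradient p f x \<bullet> (y - x) \<le> f y"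
proof -
  define v where "v = y - x"
  have v: "v \<in> carrier_vec p" using x y by (simp add: v_def)
  have gc: "gradient p f z \<in> carrier_vec p" if "z \<in> carrier_vec p" for z
    using gradient_carrier[OF diff that] .
  define h where "h t = f (x + t \<cdot>\<^sub>v v) - t * (gradient p f x \<bullet> v)" for t
  have "h 0 \<le> h 1"
  proof (rule DERIV_nonneg_imp_nondecreasing, simp)
    fix t :: real assume t: "0 \<le> t" "t \<le> 1"
    define D where "D = gradient p f (x + t \<cdot>\<^sub>v v) \<bullet> v - gradient p f x \<bullet> v"
    have "(h has_real_derivative D) (at t)"
      unfolding h_def D_def by (rule derivative_eq_intros gradient_along_segment diff x v refl | simp)+
    moreover have "D \<ge> 0"
    proof (cases "t = 0")
      case True
      then show ?thesis using x v by (simp add: D_def add_zero_smult_vec)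
    next
      case False
      have xt: "x + t \<cdot>\<^sub>v v \<in> carrier_vec p" using x v by simp
      have "x + t \<cdot>\<^sub>v v - x = t \<cdot>\<^sub>v v" using x v by (intro eq_vecI) auto
      then have "0 \<le> (gradient p f (x + t \<cdot>\<^sub>v v) - gradient p f x) \<bullet> (t \<cdot>\<^sub>v v)"
        using mono[OF xt x] by simp
      also have "\<dots> = t * D"
        using gc[OF xt] gc[OF x] v by (simp add: D_def minus_scalar_prod_distrib[of _ p])
      finally show ?thesis using t False by (simp add: zero_le_mult_iff)
    qed
    ultimately show "\<exists>D. (h has_real_derivative D) (at t) \<and> 0 \<le> D" by blast
  qed
  moreover have "x + 0 \<cdot>\<^sub>v v = x" using x v by (rule add_zero_smult_vec)
  moreover have "x + 1 \<cdot>\<^sub>v v = y" using x y by (auto simp: v_def)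
  ultimately show ?thesis by (simp add: h_def v_def)
qed

text \<open>
  Along the segment the derivative grows by at most \<open>l t |y - x|\<^sup>2\<close>, which is the derivative of
  the quadratic term.
\<close>

lemma lipschitz_gradient_below_paraboloid:
  assumes lip: "lipschitz_gradient p l f" and x: "x \<in> carrier_vec p" and y: "y \<in> carrier_vec p"
  shows "f y \<le> f x + gradient p f x \<bullet> (y - x) + l / 2 * ((y - x) \<bullet> (y - x))"
proof -
  have diff: "differentiable_vec p f" using lip by (simp add: lipschitz_gradient_def)
  define v where "v = y - x"
  have v: "v \<in> carrier_vec p" using x y by (simp add: v_def)
  have gc: "gradient p f z \<in> carrier_vec p" if "z \<in> carrier_vec p" for z
    using gradient_carrier[OF diff that] .
  define h where "h t = f (x + t \<cdot>\<^sub>v v) - t * (gradient p f x \<bullet> v) - l / 2 * t\<^sup>2 * (v \<bullet> v)" for t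
  have "h 1 \<le> h 0"
  proof (rule DERIV_nonpos_imp_nonincreasing, simp)
    fix t :: real assume t: "0 \<le> t" "t \<le> 1"
    define D where "D = gradient p f (x + t \<cdot>\<^sub>v v) \<bullet> v - gradient p f x \<bullet> v - l * t * (v \<bullet> v)"
    have "(h has_real_derivative D) (at t)"
      unfolding h_def D_def by (rule derivative_eq_intros gradient_along_segment diff x v refl | simp)+
    moreover have "D \<le> 0"
    proof -
      have xt: "x + t \<cdot>\<^sub>v v \<in> carrier_vec p" using x v by simp
      have step: "x + t \<cdot>\<^sub>v v - x = t \<cdot>\<^sub>v v" using x v by (intro eq_vecI) auto
      have "gradient p f (x + t \<cdot>\<^sub>v v) \<bullet> v - gradient p f x \<bullet> v
          = (gradient p f (x + t \<cdot>\<^sub>v v) - gradient p f x) \<bullet> v"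
        using gc[OF xt] gc[OF x] v by (simp add: minus_scalar_prod_distrib[of _ p])
      also have "\<dots> \<le> vnorm (gradient p f (x + t \<cdot>\<^sub>v v) - gradient p f x) * vnorm v"
        using gc[OF x] gc[OF xt] v by (intro scalar_prod_le_vnorm) auto
      also have "\<dots> \<le> (l * (t * vnorm v)) * vnorm v"
        using lip xt x step t unfolding lipschitz_gradient_def
        by (intro mult_right_mono) (metis abs_of_nonneg vnorm_smult, simp)
      also have "\<dots> = l * t * (v \<bullet> v)"
        by (simp add: vnorm_power2[symmetric] power2_eq_square)
      finally show ?thesis by (simp add: D_def)
    qed
    ultimately show "\<exists>D. (h has_real_derivative D) (at t) \<and> D \<le> 0" by blast
  qed
  moreover have "x + 0 \<cdot>\<^sub>v v = x" using x v by (rule add_zero_smult_vec)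
  moreover have "x + 1 \<cdot>\<^sub>v v = y" using x y by (auto simp: v_def)
  ultimately show ?thesis by (simp add: h_def v_def)
qed

text \<open>
  The Baillon-Haddad theorem. Let \<open>z\<close> be the gradient step \<open>y - (\<nabla>f(y) - \<nabla>f(x)) / l\<close> for the
  function \<open>f - \<nabla>f(x) \<bullet> _\<close>, which is minimal at \<open>x\<close>. Bounding \<open>f z\<close> from below by the tangent at
  \<open>x\<close> and from above by the paraboloid at \<open>y\<close> gives half of the claim; the other half follows by
  exchanging \<open>x\<close> and \<open>y\<close>.
\<close>

lemma gradient_cocoercive:
  assumes lip: "lipschitz_gradient p l f" and l: "0 < l"
    and mono: "\<And>x y. x \<in> carrier_vec p \<Longrightarrow> y \<in> carrier_vec p \<Longrightarrow>
      0 \<le> (gradient p f x - gradient p f y) \<bullet> (x - y)"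
    and x: "x \<in> carrier_vec p" and y: "y \<in> carrier_vec p"
  shows "(vnorm (gradient p f x - gradient p f y))\<^sup>2 / l
    \<le> (gradient p f x - gradient p f y) \<bullet> (x - y)"
proof -
  have diff: "differentiable_vec p f" using lip by (simp add: lipschitz_gradient_def)
  have gc: "gradient p f z \<in> carrier_vec p" if "z \<in> carrier_vec p" for z
    using gradient_carrier[OF diff that] .
  have half: "f x + gradient p f x \<bullet> (y - x)
      + (vnorm (gradient p f x - gradient p f y))\<^sup>2 / (2 * l) \<le> f y"
    if x: "x \<in> carrier_vec p" and y: "y \<in> carrier_vec p" for x y
  proof -
    define d where "d = gradient p f x - gradient p f y"
    have d: "d \<in> carrier_vec p" using gc[OF x] gc[OF y] by (simp add: d_def)
    define z where "z = y + (1 / l) \<cdot>\<^sub>v d"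
    have z: "z \<in> carrier_vec p" using y d by (simp add: z_def)
    have zy: "z - y = (1 / l) \<cdot>\<^sub>v d" using y d by (intro eq_vecI) (auto simp: z_def)
    have zx: "z - x = (y - x) + (1 / l) \<cdot>\<^sub>v d" using x y d by (intro eq_vecI) (auto simp: z_def)
    have "f x + gradient p f x \<bullet> (z - x) \<le> f z"
      by (rule convex_above_tangent[OF diff x z mono])
    also have "f z \<le> f y + gradient p f y \<bullet> (z - y) + l / 2 * ((z - y) \<bullet> (z - y))"
      by (rule lipschitz_gradient_below_paraboloid[OF lip y z])
    also have "l / 2 * ((z - y) \<bullet> (z - y)) = (d \<bullet> d) / (2 * l)"
      unfolding zy using l by (simp add: field_simps)
    also have "gradient p f y \<bullet> (z - y) = (gradient p f y \<bullet> d) / l"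
      unfolding zy using d gc[OF y] by simp
    also have "gradient p f x \<bullet> (z - x) = gradient p f x \<bullet> (y - x) + (gradient p f x \<bullet> d) / l"
      unfolding zx using d gc[OF x] x y by (simp add: scalar_prod_add_distrib[of _ p])
    finally have "f x + (gradient p f x \<bullet> (y - x) + (gradient p f x \<bullet> d) / l)
        \<le> f y + (gradient p f y \<bullet> d) / l + (d \<bullet> d) / (2 * l)" .
    moreover have "(gradient p f x \<bullet> d) / l - (gradient p f y \<bullet> d) / l = (d \<bullet> d) / l"
    proof -
      have "d \<bullet> d = gradient p f x \<bullet> d - gradient p f y \<bullet> d"
        using minus_scalar_prod_distrib[OF gc[OF x] gc[OF y] d] by (simp add: d_def)
      then show ?thesis by (simp add: diff_divide_distrib)
    qed
    ultimately show ?thesis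
      unfolding d_def[symmetric] vnorm_power2 by (simp add: mult.commute)
  qed
  define a where "a = gradient p f x"
  define b where "b = gradient p f y"
  have ab: "a \<in> carrier_vec p" "b \<in> carrier_vec p" using gc x y by (simp_all add: a_def b_def)
  have sym: "(vnorm (b - a))\<^sup>2 = (vnorm (a - b))\<^sup>2"
  proof -
    have "b - a = (-1) \<cdot>\<^sub>v (a - b)" using ab by (intro eq_vecI) auto
    then show ?thesis by (simp add: vnorm_smult)
  qed
  have swap: "b \<bullet> (x - y) = - (b \<bullet> (y - x))" "(a - b) \<bullet> (x - y) = - (a \<bullet> (y - x)) + b \<bullet> (y - x)"
    using ab x y by (simp_all add: scalar_prod_minus_distrib[of _ p] minus_scalar_prod_distrib[of _ p])
  have "(vnorm (a - b))\<^sup>2 / (2 * l) + (vnorm (a - b))\<^sup>2 / (2 * l) \<le> (a - b) \<bullet> (x - y)"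
    using half[OF x y] half[OF y x] unfolding a_def[symmetric] b_def[symmetric] sym swap by simp
  then show ?thesis using l by (simp add: a_def b_def field_simps)
qed

text \<open>
  Fermat's criterion for the local minimisation of the algorithm. The right-hand side is the
  update rule for the mirror variable, so this is what keeps that variable equal to the gradient.
\<close>

lemma proximal_step_gradient:
  assumes min: "is_arg_min (\<lambda>v. f v - s \<bullet> v + 1 / (2 * b) * (vnorm (v + w))\<^sup>2)
      (\<lambda>v. v \<in> carrier_vec p) x"
    and g: "has_gradient p f g x" and s: "s \<in> carrier_vec p" and w: "w \<in> carrier_vec p"
    and b: "b \<noteq> 0"
  shows "g = s - (1 / b) \<cdot>\<^sub>v (x + w)"
proof -
  have x: "x \<in> carrier_vec p" and gc: "g \<in> carrier_vec p"
    using min g by (simp_all add: is_arg_min_def has_gradient_def)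
  have le: "f x - s \<bullet> x + 1 / (2 * b) * (vnorm (x + w))\<^sup>2
      \<le> f v - s \<bullet> v + 1 / (2 * b) * (vnorm (v + w))\<^sup>2" if "v \<in> carrier_vec p" for v
    using min that by (fastforce simp: is_arg_min_def not_less)
  \<comment> \<open>The gradient of the objective at \<open>x\<close>; the test direction is this gradient itself.\<close>
  define u where "u = g - (s - (1 / b) \<cdot>\<^sub>v (x + w))"
  have u: "u \<in> carrier_vec p" using gc s x w by (simp add: u_def)
  define F where "F t = f (x + t \<cdot>\<^sub>v u) - (s \<bullet> x + t * (s \<bullet> u))
      + 1 / (2 * b) * ((x + w) \<bullet> (x + w) + 2 * t * ((x + w) \<bullet> u) + t\<^sup>2 * (u \<bullet> u))" for t
  have F: "F t = f (x + t \<cdot>\<^sub>v u) - s \<bullet> (x + t \<cdot>\<^sub>v u) + 1 / (2 * b) * (vnorm (x + t \<cdot>\<^sub>v u + w))\<^sup>2" for t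
  proof -
    have "x + t \<cdot>\<^sub>v u + w = (x + w) + t \<cdot>\<^sub>v u" using x u w by (intro eq_vecI) auto
    moreover have "((x + w) + t \<cdot>\<^sub>v u) \<bullet> ((x + w) + t \<cdot>\<^sub>v u)
        = (x + w) \<bullet> (x + w) + 2 * t * ((x + w) \<bullet> u) + t\<^sup>2 * (u \<bullet> u)"
    proof -
      have xw: "x + w \<in> carrier_vec p" and tu: "t \<cdot>\<^sub>v u \<in> carrier_vec p" using x w u by auto
      show ?thesis
        unfolding scalar_prod_add_distrib[OF add_carrier_vec[OF xw tu] xw tu]
          add_scalar_prod_distrib[OF xw tu xw] add_scalar_prod_distrib[OF xw tu tu]
          comm_scalar_prod[OF tu xw]
        using xw u by (simp add: power2_eq_square)
    qed
    ultimately show ?thesis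
      using s x u by (simp add: F_def vnorm_power2 scalar_prod_add_distrib[of _ p])
  qed
  have x0: "x + 0 \<cdot>\<^sub>v u = x" using x u by (rule add_zero_smult_vec)
  have "(F has_real_derivative g \<bullet> u - s \<bullet> u + (1 / b) * ((x + w) \<bullet> u)) (at 0)"
    unfolding F_def
    by (rule derivative_eq_intros has_gradient_along_line x u g refl | simp add: x0 g b)+
  moreover have "F 0 \<le> F t" for t
    unfolding F x0 using le[of "x + t \<cdot>\<^sub>v u"] x u by simp
  ultimately have "g \<bullet> u - s \<bullet> u + (1 / b) * ((x + w) \<bullet> u) = 0"
    by (intro DERIV_local_min[of F _ 0 1]) auto
  moreover have "u \<bullet> u = g \<bullet> u - s \<bullet> u + (1 / b) * ((x + w) \<bullet> u)"
  proof -
    have "u \<bullet> u = g \<bullet> u - (s - (1 / b) \<cdot>\<^sub>v (x + w)) \<bullet> u"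
      using minus_scalar_prod_distrib[of g p "s - (1 / b) \<cdot>\<^sub>v (x + w)" u] gc s x w u by (simp add: u_def)
    also have "(s - (1 / b) \<cdot>\<^sub>v (x + w)) \<bullet> u = s \<bullet> u - (1 / b) * ((x + w) \<bullet> u)"
      using minus_scalar_prod_distrib[of s p "(1 / b) \<cdot>\<^sub>v (x + w)" u] s x w u by simp
    finally show ?thesis by simp
  qed
  ultimately have "u = 0\<^sub>v p" using scalar_prod_self_eq_0[OF u] by simp
  then have "u $ i = 0" if "i < p" for i using that by simp
  then show ?thesis using gc s x w by (intro eq_vecI) (auto simp: u_def)
qed

text \<open>
  The Lagrange condition for the coupling constraint: moving resources from agent \<open>j\<close> to agent \<open>i\<close>
  in the direction of the difference of their gradients preserves feasibility and changes the cost
  at a rate equal to the squared norm of that difference.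
\<close>

lemma optimal_allocation_equal_gradients:
  assumes opt: "optimal_allocation n p f R X" and R: "R \<in> carrier_mat n p"
    and diff: "\<And>i. i < n \<Longrightarrow> differentiable_vec p (f i)"
    and i: "i < n" and j: "j < n"
  shows "gradient p (f i) (row X i) = gradient p (f j) (row X j)"
proof (cases "i = j")
  case False
  have X: "X \<in> carrier_mat n p" and feas: "feasible n p R X"
    and min: "\<And>Z. feasible n p R Z \<Longrightarrow> total_cost n f X \<le> total_cost n f Z"
    using opt by (auto simp: optimal_allocation_def is_arg_min_def feasible_def not_less)
  have rX: "row X k \<in> carrier_vec p" if "k < n" for k using X that by auto
  define g where "g k = gradient p (f k) (row X k)" for k
  have gc: "g k \<in> carrier_vec p" if "k < n" for k
    unfolding g_def using gradient_carrier[OF diff[OF that] rX[OF that]] .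
  define u where "u = g i - g j"
  have u: "u \<in> carrier_vec p" using gc i j by (simp add: u_def)
  \<comment> \<open>The signs with which the agents take part in the exchange; they sum to zero.\<close>
  define w :: "nat \<Rightarrow> real" where "w k = (if k = i then 1 else if k = j then -1 else 0)" for k
  have w_sum: "(\<Sum>k<n. w k * a k) = a i - a j" for a :: "nat \<Rightarrow> real"
  proof -
    have "(\<Sum>k<n. w k * a k) = (\<Sum>k<n. (if k = i then a i else 0) - (if k = j then a j else 0))"
      using False by (intro sum.cong) (auto simp: w_def)
    then show ?thesis using i j by (simp add: sum_subtractf)
  qed
  define Z where "Z t = mat n p (\<lambda>(k, m). X $$ (k, m) + t * w k * u $ m)" for t
  have rowZ: "row (Z t) k = row X k + (t * w k) \<cdot>\<^sub>v u" if "k < n" for t k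
    using X u that by (intro eq_vecI) (auto simp: Z_def)
  have feasZ: "feasible n p R (Z t)" for t
  proof -
    have "finsum_vec TYPE(real) p (\<lambda>k. row (Z t) k - row R k) {..<n}
        = finsum_vec TYPE(real) p (\<lambda>k. row X k - row R k) {..<n}"
    proof (rule eq_vecI)
      fix m assume "m < dim_vec (finsum_vec TYPE(real) p (\<lambda>k. row X k - row R k) {..<n})"
      moreover have "finsum_vec TYPE(real) p (\<lambda>k. row X k - row R k) {..<n} \<in> carrier_vec p"
        using X R by (intro finsum_vec_closed) auto
      ultimately have m: "m < p" by simp
      have "(\<Sum>k<n. t * w k * u $ m) = t * u $ m * (\<Sum>k<n. w k * 1)"
        by (simp add: sum_distrib_left algebra_simps)
      also have "\<dots> = 0" unfolding w_sum by simp
      finally have zero: "(\<Sum>k<n. t * w k * u $ m) = 0" .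
      have "finsum_vec TYPE(real) p (\<lambda>k. row (Z t) k - row R k) {..<n} $ m
          = (\<Sum>k<n. (row (Z t) k - row R k) $ m)"
        using R m by (intro index_finsum_vec) (auto simp: Z_def)
      also have "\<dots> = (\<Sum>k<n. (row X k - row R k) $ m + t * w k * u $ m)"
        using X R u m by (intro sum.cong) (auto simp: rowZ)
      also have "\<dots> = (\<Sum>k<n. (row X k - row R k) $ m)" by (simp add: sum.distrib zero)
      also have "\<dots> = finsum_vec TYPE(real) p (\<lambda>k. row X k - row R k) {..<n} $ m"
        using X R m by (intro index_finsum_vec[symmetric]) auto
      finally show "finsum_vec TYPE(real) p (\<lambda>k. row (Z t) k - row R k) {..<n} $ m = \<dots>" .
    next
      have "finsum_vec TYPE(real) p (\<lambda>k. row (Z t) k - row R k) {..<n} \<in> carrier_vec p"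
        "finsum_vec TYPE(real) p (\<lambda>k. row X k - row R k) {..<n} \<in> carrier_vec p"
        using X R by (auto intro!: finsum_vec_closed simp: Z_def)
      then show "dim_vec (finsum_vec TYPE(real) p (\<lambda>k. row (Z t) k - row R k) {..<n})
          = dim_vec (finsum_vec TYPE(real) p (\<lambda>k. row X k - row R k) {..<n})" by simp
    qed
    then show ?thesis using feas by (simp add: feasible_def Z_def)
  qed
  define F where "F t = (\<Sum>k<n. f k (row X k + t \<cdot>\<^sub>v (w k \<cdot>\<^sub>v u)))" for t
  have F: "F t = total_cost n f (Z t)" for t
    by (simp add: F_def total_cost_def rowZ smult_smult_assoc)
  have "(F has_real_derivative (\<Sum>k<n. g k \<bullet> (w k \<cdot>\<^sub>v u))) (at 0)"
    unfolding F_def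
  proof (rule DERIV_sum)
    fix k assume "k \<in> {..<n}"
    then have k: "k < n" by simp
    have "row X k + 0 \<cdot>\<^sub>v (w k \<cdot>\<^sub>v u) = row X k"
      using rX[OF k] u by (intro add_zero_smult_vec) auto
    then show "((\<lambda>t. f k (row X k + t \<cdot>\<^sub>v (w k \<cdot>\<^sub>v u))) has_real_derivative g k \<bullet> (w k \<cdot>\<^sub>v u)) (at 0)"
      using has_gradient_gradient[OF diff[OF k] rX[OF k]] rX[OF k] u
      by (intro has_gradient_along_line) (auto simp: g_def)
  qed
  moreover have "F 0 \<le> F t" for t
  proof -
    have "F 0 = total_cost n f X"
      unfolding F total_cost_def using rX u
      by (intro sum.cong) (auto simp: rowZ add_zero_smult_vec[of _ p])
    then show ?thesis using min[OF feasZ] by (simp add: F)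
  qed
  ultimately have "(\<Sum>k<n. g k \<bullet> (w k \<cdot>\<^sub>v u)) = 0"
    by (intro DERIV_local_min[of F _ 0 1]) auto
  moreover have "(\<Sum>k<n. g k \<bullet> (w k \<cdot>\<^sub>v u)) = (\<Sum>k<n. w k * (g k \<bullet> u))"
    using gc u by (intro sum.cong) auto
  ultimately have "g i \<bullet> u - g j \<bullet> u = 0" by (simp add: w_sum)
  then have "u \<bullet> u = 0"
    using minus_scalar_prod_distrib[OF gc[OF i] gc[OF j] u] by (simp add: u_def)
  then have "u = 0\<^sub>v p" using scalar_prod_self_eq_0[OF u] by simp
  then have "u $ k = 0" if "k < p" for k using that by simp
  then have "g i = g j" using gc[OF i] gc[OF j] by (intro eq_vecI) (auto simp: u_def)
  then show ?thesis by (simp add: g_def)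
qed simp

lemma stacked_gradient_carrier [simp]: "stacked_gradient n p f X \<in> carrier_mat n p"
  using mat_of_rows_carrier(1)[of p "map (\<lambda>i. gradient p (f i) (row X i)) [0..<n]"]
  by (simp add: stacked_gradient_def)

lemma dim_stacked_gradient [simp]:
  "dim_row (stacked_gradient n p f X) = n" "dim_col (stacked_gradient n p f X) = p"
  using carrier_matD[OF stacked_gradient_carrier] by auto

lemma row_minus_mat:
  assumes "A \<in> carrier_mat n p" "B \<in> carrier_mat n p" "i < n"
  shows "row (A - B) i = row A i - row B i"
  using assms by (intro eq_vecI) auto

lemma row_stacked_gradient:
  assumes "X \<in> carrier_mat n p" "i < n" "differentiable_vec p (f i)"
  shows "row (stacked_gradient n p f X) i = gradient p (f i) (row X i)"
  using assms gradient_carrier[of p "f i" "row X i"] by (simp add: stacked_gradient_def)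

text \<open>
  Needs a direction to move in, hence the hypothesis on the dimension. It makes the Lipschitz
  constants positive.
\<close>

lemma lipschitz_ge_strong_convexity:
  assumes p: "0 < p" and lip: "lipschitz_gradient p l f" and strong: "strongly_convex p m f"
  shows "m \<le> l"
proof -
  define e :: "real vec" where "e = unit_vec p 0"
  have e: "e \<in> carrier_vec p" "e - 0\<^sub>v p = e" by (auto simp: e_def)
  have "e \<bullet> e = 1" using p by (simp add: e_def)
  then have norm: "vnorm e = 1" by (simp add: vnorm_def)
  have diff: "differentiable_vec p f" using lip by (simp add: lipschitz_gradient_def)
  define d where "d = gradient p f e - gradient p f (0\<^sub>v p)"
  have d: "d \<in> carrier_vec p"
    using gradient_carrier[OF diff] e by (simp add: d_def)
  have "m * (vnorm (e - 0\<^sub>v p))\<^sup>2 \<le> d \<bullet> (e - 0\<^sub>v p)"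
    using strong e(1) unfolding strongly_convex_def d_def by (meson zero_carrier_vec)
  also have "\<dots> \<le> vnorm d * vnorm e"
    unfolding e(2) using d e by (intro scalar_prod_le_vnorm) auto
  also have "vnorm d \<le> l * vnorm (e - 0\<^sub>v p)"
    using lip e(1) unfolding lipschitz_gradient_def d_def by (meson zero_carrier_vec)
  finally show ?thesis by (simp add: e(2) norm)
qed

lemma stacked_gradient_strongly_monotone:
  assumes X: "X \<in> carrier_mat n p" "Z \<in> carrier_mat n p"
    and f: "\<And>i. i < n \<Longrightarrow> strongly_convex p (mus i) (f i)"
    and mu: "\<And>i. i < n \<Longrightarrow> \<mu> \<le> mus i"
  shows "\<mu> * frob (X - Z) (X - Z)
    \<le> frob (stacked_gradient n p f X - stacked_gradient n p f Z) (X - Z)"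
proof -
  let ?g = "stacked_gradient n p f"
  have diff: "differentiable_vec p (f i)" if "i < n" for i
    using f[OF that] by (simp add: strongly_convex_def)
  have XZ: "X - Z \<in> carrier_mat n p" "?g X - ?g Z \<in> carrier_mat n p"
    using X by (auto intro!: minus_carrier_mat)
  have "\<mu> * frob (X - Z) (X - Z) = (\<Sum>i<n. \<mu> * (row (X - Z) i \<bullet> row (X - Z) i))"
    using XZ by (simp add: frob_rows sum_distrib_left)
  also have "\<dots> \<le> (\<Sum>i<n. row (?g X - ?g Z) i \<bullet> row (X - Z) i)"
  proof (rule sum_mono)
    fix i assume "i \<in> {..<n}"
    then have i: "i < n" by simp
    have rows: "row (X - Z) i = row X i - row Z i"
      "row (?g X - ?g Z) i = gradient p (f i) (row X i) - gradient p (f i) (row Z i)"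
      using X i diff[OF i] by (simp_all add: row_minus_mat[of _ n p] row_stacked_gradient)
    have "row X i \<in> carrier_vec p" "row Z i \<in> carrier_vec p" using X i by auto
    then have "mus i * (vnorm (row (X - Z) i))\<^sup>2 \<le> row (?g X - ?g Z) i \<bullet> row (X - Z) i"
      using f[OF i] unfolding rows strongly_convex_def by blast
    moreover have "\<mu> * (vnorm (row (X - Z) i))\<^sup>2 \<le> mus i * (vnorm (row (X - Z) i))\<^sup>2"
      using mu[OF i] by (rule mult_right_mono) simp
    ultimately show "\<mu> * (row (X - Z) i \<bullet> row (X - Z) i) \<le> row (?g X - ?g Z) i \<bullet> row (X - Z) i"
      by (simp add: vnorm_power2)
  qed
  also have "\<dots> = frob (?g X - ?g Z) (X - Z)" using XZ by (simp add: frob_rows)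
  finally show ?thesis .
qed

lemma stacked_gradient_cocoercive:
  assumes X: "X \<in> carrier_mat n p" "Z \<in> carrier_mat n p"
    and f: "\<And>i. i < n \<Longrightarrow> lipschitz_gradient p (lips i) (f i)"
      "\<And>i. i < n \<Longrightarrow> strongly_convex p (mus i) (f i)" "\<And>i. i < n \<Longrightarrow> 0 < mus i"
    and l: "\<And>i. i < n \<Longrightarrow> lips i \<le> l" "\<And>i. i < n \<Longrightarrow> 0 < lips i"
  shows "frob (stacked_gradient n p f X - stacked_gradient n p f Z)
      (stacked_gradient n p f X - stacked_gradient n p f Z)
    \<le> l * frob (stacked_gradient n p f X - stacked_gradient n p f Z) (X - Z)"
proof -
  let ?g = "stacked_gradient n p f"
  have diff: "differentiable_vec p (f i)" if "i < n" for i
    using f(2)[OF that] by (simp add: strongly_convex_def)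
  have XZ: "X - Z \<in> carrier_mat n p" "?g X - ?g Z \<in> carrier_mat n p"
    using X by (auto intro!: minus_carrier_mat)
  have "frob (?g X - ?g Z) (?g X - ?g Z) = (\<Sum>i<n. row (?g X - ?g Z) i \<bullet> row (?g X - ?g Z) i)"
    using XZ by (simp add: frob_rows)
  also have "\<dots> \<le> (\<Sum>i<n. l * (row (?g X - ?g Z) i \<bullet> row (X - Z) i))"
  proof (rule sum_mono)
    fix i assume "i \<in> {..<n}"
    then have i: "i < n" by simp
    have rows: "row (X - Z) i = row X i - row Z i"
      "row (?g X - ?g Z) i = gradient p (f i) (row X i) - gradient p (f i) (row Z i)"
      using X i diff[OF i] by (simp_all add: row_minus_mat[of _ n p] row_stacked_gradient)
    have carr: "row X i \<in> carrier_vec p" "row Z i \<in> carrier_vec p" using X i by auto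
    have mono: "0 \<le> (gradient p (f i) x - gradient p (f i) y) \<bullet> (x - y)"
      if "x \<in> carrier_vec p" "y \<in> carrier_vec p" for x y
    proof -
      have "mus i * (vnorm (x - y))\<^sup>2 \<le> (gradient p (f i) x - gradient p (f i) y) \<bullet> (x - y)"
        using f(2)[OF i] that unfolding strongly_convex_def by blast
      moreover have "0 \<le> mus i * (vnorm (x - y))\<^sup>2" using f(3)[OF i] by simp
      ultimately show ?thesis by linarith
    qed
    let ?a = "row (?g X - ?g Z) i" and ?b = "row (X - Z) i"
    have "(vnorm ?a)\<^sup>2 / lips i \<le> ?a \<bullet> ?b"
      unfolding rows by (rule gradient_cocoercive[OF f(1)[OF i] l(2)[OF i] mono carr])
    then have "?a \<bullet> ?a \<le> lips i * (?a \<bullet> ?b)"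
      using l(2)[OF i] by (simp add: vnorm_power2 field_simps)
    also have "\<dots> \<le> l * (?a \<bullet> ?b)"
      unfolding rows using l(1)[OF i] mono[OF carr] by (rule mult_right_mono)
    finally show "?a \<bullet> ?a \<le> l * (?a \<bullet> ?b)" .
  qed
  also have "\<dots> = l * frob (?g X - ?g Z) (X - Z)"
    using XZ by (simp add: frob_rows sum_distrib_left)
  finally show ?thesis .
qed

section \<open>A Poincare inequality on connected graphs\<close>

lemma walk_segment_relpow:
  assumes walk: "\<And>i. i < m \<Longrightarrow> (u i, u (Suc i)) \<in> E" and "i \<le> j" "j \<le> m"
  shows "(u i, u j) \<in> E ^^ (j - i)"
  unfolding relpow_fun_conv
  using assms by (intro exI[of _ "\<lambda>k. u (i + k)"]) auto

text \<open>
  Two vertices of a shortest path with a common neighbour are at most two steps apart on the path,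
  since otherwise the neighbour would be a shortcut. Hence every vertex is adjacent to at most three
  vertices of the path, and counting the incident pairs by their other end gives the bound.
\<close>

lemma geodesic_degree_sum:
  assumes V: "finite V" "E \<subseteq> V \<times> V" and sym: "sym E"
    and walk: "\<And>i. i < m \<Longrightarrow> (u i, u (Suc i)) \<in> E"
    and shortest: "\<And>k. (u 0, u m) \<in> E ^^ k \<Longrightarrow> m \<le> k"
  shows "(\<Sum>i\<le>m. card {x. (u i, x) \<in> E}) \<le> 3 * card V"
proof -
  have near: "j \<le> i + 2" if x: "(u i, x) \<in> E" "(u j, x) \<in> E" and ij: "i \<le> j" "j \<le> m" for i j x
  proof -
    have "(x, u j) \<in> E" using x sym by (auto dest: symD)
    then have "(u i, u j) \<in> E ^^ 2" using x by (auto simp: numeral_2_eq_2)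
    moreover have "(u 0, u i) \<in> E ^^ i" "(u j, u m) \<in> E ^^ (m - j)"
      using walk_segment_relpow[of m u E 0 i] walk_segment_relpow[of m u E j m] walk ij by auto
    ultimately have "(u 0, u m) \<in> E ^^ (i + 2 + (m - j))"
      unfolding relpow_add by blast
    from shortest[OF this] ij show ?thesis by linarith
  qed
  have three: "card {i. i \<le> m \<and> (u i, x) \<in> E} \<le> 3" for x
  proof (cases "{i. i \<le> m \<and> (u i, x) \<in> E} = {}")
    case False
    define a where "a = Min {i. i \<le> m \<and> (u i, x) \<in> E}"
    have fin: "finite {i. i \<le> m \<and> (u i, x) \<in> E}" by simp
    have a: "(u a, x) \<in> E" "\<And>i. i \<le> m \<Longrightarrow> (u i, x) \<in> E \<Longrightarrow> a \<le> i"
      using Min_in[OF fin False] Min_le[OF fin] by (auto simp: a_def)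
    have "{i. i \<le> m \<and> (u i, x) \<in> E} \<subseteq> {a..a + 2}"
      using near[OF a(1)] a(2) by auto
    from card_mono[OF _ this] show ?thesis by simp
  next
    case True
    then show ?thesis by (metis card.empty zero_le)
  qed
  have "(\<Sum>i\<le>m. card {x. (u i, x) \<in> E}) = (\<Sum>i\<le>m. \<Sum>x\<in>V. of_bool ((u i, x) \<in> E))"
  proof (rule sum.cong[OF refl])
    fix i
    have "{x. (u i, x) \<in> E} = V \<inter> {x. (u i, x) \<in> E}" using V by auto
    then show "card {x. (u i, x) \<in> E} = (\<Sum>x\<in>V. of_bool ((u i, x) \<in> E))"
      using V(1) by simp
  qed
  also have "\<dots> = (\<Sum>x\<in>V. \<Sum>i\<le>m. of_bool ((u i, x) \<in> E))" by (rule sum.swap)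
  also have "\<dots> = (\<Sum>x\<in>V. card {i. i \<le> m \<and> (u i, x) \<in> E})"
  proof (rule sum.cong[OF refl])
    fix x
    have "{..m} \<inter> {i. (u i, x) \<in> E} = {i. i \<le> m \<and> (u i, x) \<in> E}" by auto
    then show "(\<Sum>i\<le>m. of_bool ((u i, x) \<in> E)) = card {i. i \<le> m \<and> (u i, x) \<in> E}" by simp
  qed
  also have "\<dots> \<le> (\<Sum>x\<in>V. 3)" by (intro sum_mono three)
  finally show ?thesis by simp
qed

lemma geodesic_inj:
  assumes walk: "\<And>i. i < m \<Longrightarrow> (u i, u (Suc i)) \<in> E"
    and shortest: "\<And>k. (u 0, u m) \<in> E ^^ k \<Longrightarrow> m \<le> k"
  shows "inj_on u {..m}"
proof -
  have False if ij: "i < j" "j \<le> m" "u i = u j" for i j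
  proof -
    have "(u 0, u i) \<in> E ^^ i" "(u j, u m) \<in> E ^^ (m - j)"
      using walk_segment_relpow[of m u E 0 i] walk_segment_relpow[of m u E j m] walk ij by auto
    then have "(u 0, u m) \<in> E ^^ (i + (m - j))" using ij(3) unfolding relpow_add by auto
    from shortest[OF this] ij show False by linarith
  qed
  then show ?thesis by (metis atMost_iff inj_onI linorder_neqE_nat)
qed

text \<open>
  In electrical terms, the resistance of an edge: the Metropolis weight is half of its reciprocal.
\<close>

definition max_degree :: "'a rel \<Rightarrow> 'a \<Rightarrow> 'a \<Rightarrow> real" where
  "max_degree E x y = real (max (card {z. (x, z) \<in> E}) (card {z. (y, z) \<in> E}))"

text \<open>
  Cauchy-Schwarz along a shortest path from \<open>s\<close> to \<open>t\<close>, with the edges weighted by \<open>max_degree\<close>. The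
  total weight is at most twice the degree sum of the path, and the path uses every arc at most
  once.
\<close>

lemma difference_le_dirichlet_energy:
  fixes v :: "'a \<Rightarrow> real"
  assumes V: "finite V" "E \<subseteq> V \<times> V" and sym: "sym E" and reach: "(s, t) \<in> E\<^sup>*"
  shows "(v s - v t)\<^sup>2 \<le> 6 * real (card V) * (\<Sum>(x, y)\<in>E. (v x - v y)\<^sup>2 / max_degree E x y)"
proof -
  have finE: "finite E" using V by (meson finite_SigmaI finite_subset)
  define m where "m = (LEAST k. (s, t) \<in> E ^^ k)"
  have "\<exists>k. (s, t) \<in> E ^^ k" using reach by (auto simp: rtrancl_power)
  then have m: "(s, t) \<in> E ^^ m" unfolding m_def by (rule LeastI_ex)
  then obtain u where u: "u 0 = s" "u m = t" and walk: "\<And>i. i < m \<Longrightarrow> (u i, u (Suc i)) \<in> E"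
    unfolding relpow_fun_conv by blast
  have shortest: "m \<le> k" if "(u 0, u m) \<in> E ^^ k" for k
    using that u by (auto simp: m_def intro: Least_le)
  define d where "d i = card {x. (u i, x) \<in> E}" for i
  define D where "D i = max_degree E (u i) (u (Suc i))" for i
  have D: "D i = real (max (d i) (d (Suc i)))" for i by (simp add: D_def d_def max_degree_def)
  have D_pos: "D i > 0" if "i < m" for i
  proof -
    have "finite {x. (u i, x) \<in> E}" using V by (auto intro: finite_subset[of _ V])
    then have "d i > 0" using walk[OF that] by (auto simp: d_def card_gt_0_iff)
    then show ?thesis by (simp add: D)
  qed
  have D_sum: "(\<Sum>i<m. D i) \<le> 6 * real (card V)"
  proof -
    have "(\<Sum>i<m. D i) \<le> (\<Sum>i<m. real (d i) + real (d (Suc i)))"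
      by (intro sum_mono) (simp add: D)
    also have "\<dots> = (\<Sum>i<m. real (d i)) + (\<Sum>i\<in>Suc ` {..<m}. real (d i))"
      by (simp add: sum.distrib sum.reindex)
    also have "\<dots> \<le> (\<Sum>i\<le>m. real (d i)) + (\<Sum>i\<le>m. real (d i))"
      by (intro add_mono sum_mono2) auto
    also have "\<dots> = 2 * real (\<Sum>i\<le>m. d i)" by simp
    also have "\<dots> \<le> 2 * real (3 * card V)"
      using geodesic_degree_sum[OF V sym, of m u] walk shortest unfolding d_def
      by (intro mult_left_mono of_nat_mono) auto
    finally show ?thesis by simp
  qed
  have "v s - v t = (\<Sum>i<m. v (u i) - v (u (Suc i)))"
    using sum_lessThan_telescope'[of "\<lambda>i. v (u i)" m] u by simp
  also have "\<dots> = (\<Sum>i<m. sqrt (D i) * ((v (u i) - v (u (Suc i))) / sqrt (D i)))"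
    using D_pos by (intro sum.cong) (auto simp: less_le)
  finally have telescope:
    "v s - v t = (\<Sum>i<m. sqrt (D i) * ((v (u i) - v (u (Suc i))) / sqrt (D i)))" .
  have "(v s - v t)\<^sup>2
      \<le> (\<Sum>i<m. (sqrt (D i))\<^sup>2) * (\<Sum>i<m. ((v (u i) - v (u (Suc i))) / sqrt (D i))\<^sup>2)"
    unfolding telescope by (rule Cauchy_Schwarz_sum)
  also have "(\<Sum>i<m. (sqrt (D i))\<^sup>2) = (\<Sum>i<m. D i)"
    by (intro sum.cong) (auto simp: D)
  also have "(\<Sum>i<m. ((v (u i) - v (u (Suc i))) / sqrt (D i))\<^sup>2)
      = (\<Sum>i<m. (v (u i) - v (u (Suc i)))\<^sup>2 / D i)"
    by (intro sum.cong) (auto simp: D power_divide)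
  also have "\<dots> = (\<Sum>(x, y)\<in>(\<lambda>i. (u i, u (Suc i))) ` {..<m}. (v x - v y)\<^sup>2 / max_degree E x y)"
  proof -
    have "inj_on (\<lambda>i. (u i, u (Suc i))) {..<m}"
      using geodesic_inj[of m u E] walk shortest by (auto simp: inj_on_def)
    then show ?thesis by (simp add: sum.reindex D_def)
  qed
  also have "(\<Sum>i<m. D i) * \<dots> \<le> (6 * real (card V)) * (\<Sum>(x, y)\<in>E. (v x - v y)\<^sup>2 / max_degree E x y)"
    using walk D_sum
    by (intro mult_mono sum_mono2 finE sum_nonneg) (auto simp: max_degree_def)
  finally show ?thesis .
qed

text \<open>
  For a function of mean zero the sum of squares is at most the sum of the squared differences to
  the value at any fixed vertex.
\<close>

lemma poincare_inequality:
  fixes v :: "'a \<Rightarrow> real"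
  assumes V: "finite V" "E \<subseteq> V \<times> V" and sym: "sym E"
    and conn: "\<And>s t. s \<in> V \<Longrightarrow> t \<in> V \<Longrightarrow> (s, t) \<in> E\<^sup>*"
    and mean: "(\<Sum>x\<in>V. v x) = 0"
  shows "(\<Sum>x\<in>V. (v x)\<^sup>2) \<le> 6 * (real (card V))\<^sup>2 * (\<Sum>(x, y)\<in>E. (v x - v y)\<^sup>2 / max_degree E x y)"
proof (cases "V = {}")
  case False
  then obtain t where t: "t \<in> V" by blast
  have cross: "(\<Sum>x\<in>V. 2 * v x * v t) = 2 * v t * (\<Sum>x\<in>V. v x)"
    by (subst sum_distrib_left) (simp add: mult_ac)
  have "(\<Sum>x\<in>V. (v x)\<^sup>2) \<le> (\<Sum>x\<in>V. (v x)\<^sup>2) + real (card V) * (v t)\<^sup>2 - 2 * v t * (\<Sum>x\<in>V. v x)"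
    unfolding mean by simp
  also have "\<dots> = (\<Sum>x\<in>V. (v x - v t)\<^sup>2)"
    by (simp add: power2_diff sum.distrib sum_subtractf cross)
  also have "\<dots> \<le> (\<Sum>x\<in>V. 6 * real (card V) * (\<Sum>(x, y)\<in>E. (v x - v y)\<^sup>2 / max_degree E x y))"
    by (intro sum_mono difference_le_dirichlet_energy V sym conn t)
  finally show ?thesis by (simp add: power2_eq_square)
next
  case True
  then show ?thesis by simp
qed

section \<open>The spectrum of the Metropolis Laplacian\<close>

lemma pair_graph_facts:
  assumes "pair_graph G"
  shows pair_graph_sym: "sym (parcs G)"
    and pair_graph_irrefl: "(i, i) \<notin> parcs G"
    and pair_graph_arcs: "parcs G \<subseteq> pverts G \<times> pverts G"
proof -
  interpret pair_graph G by fact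
  show "sym (parcs G)" using pair_sym_arcs by (simp add: symmetric_def)
  show "(i, i) \<notin> parcs G" using pair_no_loops[of "(i, i)"] by auto
  show "parcs G \<subseteq> pverts G \<times> pverts G" using wellformed' by auto
qed

lemma pair_graph_connected:
  assumes "pair_graph G" "Digraph_Component.connected (with_proj G)"
  shows "pverts G \<noteq> {}"
    and "s \<in> pverts G \<Longrightarrow> t \<in> pverts G \<Longrightarrow> (s, t) \<in> (parcs G)\<^sup>*"
proof -
  interpret pair_graph G by fact
  have parcs: "parcs (mk_symmetric (with_proj G)) = parcs G"
    using adj_mk_symmetric_eq[OF pair_sym_arcs] by simp
  have conn: "strongly_connected (with_proj (mk_symmetric (with_proj G)))"
    using assms(2) by (simp add: Digraph_Component.connected_def)
  then show "pverts G \<noteq> {}" by (simp add: strongly_connected_def)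
  show "(s, t) \<in> (parcs G)\<^sup>*" if "s \<in> pverts G" "t \<in> pverts G"
  proof -
    have "reachable (with_proj (mk_symmetric (with_proj G))) s t"
      using conn that by (simp add: strongly_connected_def)
    then show ?thesis
      using parcs by (auto simp: reachable_def dest: rtrancl_on_rtranclI)
  qed
qed

lemma metropolis_weight_commute: "metropolis_weight G i j = metropolis_weight G j i"
  by (simp add: metropolis_weight_def max.commute)

lemma metropolis_weight_nonneg: "0 \<le> metropolis_weight G i j"
  by (simp add: metropolis_weight_def)

lemma metropolis_weight_max_degree: "metropolis_weight G i j = 1 / (2 * max_degree (parcs G) i j)"
  by (simp add: metropolis_weight_def max_degree_def neighbors_def)

lemma metropolis_laplacian_carrier [simp]: "metropolis_laplacian n G \<in> carrier_mat n n"
  by (simp add: metropolis_laplacian_def lazy_metropolis_def minus_carrier_mat)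

lemma sum_sym_relation:
  assumes "sym E"
  shows "(\<Sum>(x, y)\<in>E. F x y) = (\<Sum>(x, y)\<in>E. F y x)"
  using assms by (intro sum.reindex_bij_witness[of _ prod.swap prod.swap]) (auto dest: symD)

context
  fixes n :: nat and G :: "nat pair_pre_digraph"
  assumes G: "pair_graph G" "pverts G = {..<n}"
begin

lemma neighbors_less: "neighbors G i \<subseteq> {..<n}"
  using pair_graph_arcs[OF G(1)] G(2) by (auto simp: neighbors_def)

lemma finite_neighbors: "finite (neighbors G i)"
  using neighbors_less finite_subset by blast

lemma sum_arcs: "(\<Sum>(i, j)\<in>parcs G. F i j) = (\<Sum>i<n. \<Sum>j\<in>neighbors G i. F i j)"
  for F :: "nat \<Rightarrow> nat \<Rightarrow> real"
proof -
  have "parcs G = (SIGMA i:{..<n}. neighbors G i)"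
    using pair_graph_arcs[OF G(1)] G(2) by (auto simp: neighbors_def)
  then show ?thesis by (simp add: sum.Sigma finite_neighbors)
qed

lemma metropolis_laplacian_index:
  assumes "i < n" "j < n"
  shows "metropolis_laplacian n G $$ (i, j) =
    ((if i = j then \<Sum>l\<in>neighbors G i. metropolis_weight G i l else 0)
      - (if j \<in> neighbors G i then metropolis_weight G i j else 0)) / 2"
  using assms pair_graph_irrefl[OF G(1)]
  by (auto simp: metropolis_laplacian_def lazy_metropolis_def neighbors_def)

lemma metropolis_laplacian_apply:
  assumes i: "i < n"
  shows "(\<Sum>j<n. metropolis_laplacian n G $$ (i, j) * a j)
    = (\<Sum>j\<in>neighbors G i. metropolis_weight G i j * (a i - a j)) / 2"
proof -
  let ?w = "metropolis_weight G i"
  have "(\<Sum>j<n. metropolis_laplacian n G $$ (i, j) * a j)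
      = (\<Sum>j<n. ((if j = i then (\<Sum>l\<in>neighbors G i. ?w l) * a i else 0)
          - (if j \<in> neighbors G i then ?w j * a j else 0)) / 2)"
    using i by (intro sum.cong) (auto simp: metropolis_laplacian_index left_diff_distrib)
  also have "\<dots> = ((\<Sum>l\<in>neighbors G i. ?w l) * a i - (\<Sum>j\<in>{..<n} \<inter> neighbors G i. ?w j * a j)) / 2"
    using i by (simp add: sum_divide_distrib[symmetric] sum_subtractf sum.inter_restrict)
  also have "{..<n} \<inter> neighbors G i = neighbors G i" using neighbors_less by auto
  finally show ?thesis
    by (simp add: sum_distrib_right sum_subtractf right_diff_distrib)
qed

text \<open>
  The factor is \<open>1/4\<close> because \<open>parcs G\<close> contains every edge in both directions and the Laplacian
  is half of \<open>I - W\<close>.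
\<close>

lemma metropolis_laplacian_quadratic_form:
  assumes v: "v \<in> carrier_vec n"
  shows "v \<bullet> (metropolis_laplacian n G *\<^sub>v v)
    = (\<Sum>(i, j)\<in>parcs G. metropolis_weight G i j * (v $ i - v $ j)\<^sup>2) / 4"
proof -
  let ?w = "metropolis_weight G"
  let ?S = "\<lambda>F. \<Sum>(i, j)\<in>parcs G. F i j"
  have mult: "(metropolis_laplacian n G *\<^sub>v v) $ i
      = (\<Sum>j\<in>neighbors G i. ?w i j * (v $ i - v $ j)) / 2" if "i < n" for i
    using that v carrier_matD[OF metropolis_laplacian_carrier[of n G]]
      metropolis_laplacian_apply[OF that, of "vec_index v"]
    by (simp add: scalar_prod_def atLeast0LessThan)
  have "v \<bullet> (metropolis_laplacian n G *\<^sub>v v)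
      = (\<Sum>i<n. \<Sum>j\<in>neighbors G i. ?w i j * ((v $ i)\<^sup>2 - v $ i * v $ j)) / 2"
  proof -
    have "v \<bullet> (metropolis_laplacian n G *\<^sub>v v)
        = (\<Sum>i<n. v $ i * (metropolis_laplacian n G *\<^sub>v v) $ i)"
      using carrier_matD[OF metropolis_laplacian_carrier[of n G]]
      by (simp add: scalar_prod_def[of v] atLeast0LessThan)
    also have "\<dots> = (\<Sum>i<n. v $ i * ((\<Sum>j\<in>neighbors G i. ?w i j * (v $ i - v $ j)) / 2))"
      by (intro sum.cong) (auto simp: mult)
    also have "\<dots> = (\<Sum>i<n. \<Sum>j\<in>neighbors G i. ?w i j * ((v $ i)\<^sup>2 - v $ i * v $ j)) / 2"
      by (simp add: sum_distrib_left sum_divide_distrib power2_eq_square algebra_simps)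
    finally show ?thesis .
  qed
  also have "\<dots> = (\<Sum>(i, j)\<in>parcs G. ?w i j * ((v $ i)\<^sup>2 - v $ i * v $ j)) / 2"
    by (simp add: sum_arcs)
  also have "2 * (\<Sum>(i, j)\<in>parcs G. ?w i j * ((v $ i)\<^sup>2 - v $ i * v $ j))
      = (\<Sum>(i, j)\<in>parcs G. ?w i j * ((v $ i)\<^sup>2 - v $ i * v $ j))
        + (\<Sum>(i, j)\<in>parcs G. ?w j i * ((v $ j)\<^sup>2 - v $ j * v $ i))"
    using sum_sym_relation[OF pair_graph_sym[OF G(1)], of "\<lambda>i j. ?w i j * ((v $ i)\<^sup>2 - v $ i * v $ j)"]
    by simp
  then have "(\<Sum>(i, j)\<in>parcs G. ?w i j * ((v $ i)\<^sup>2 - v $ i * v $ j)) / 2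
      = ((\<Sum>(i, j)\<in>parcs G. ?w i j * ((v $ i)\<^sup>2 - v $ i * v $ j))
        + (\<Sum>(i, j)\<in>parcs G. ?w j i * ((v $ j)\<^sup>2 - v $ j * v $ i))) / 4"
    by simp
  also have "\<dots> = (\<Sum>(i, j)\<in>parcs G. ?w i j * (v $ i - v $ j)\<^sup>2) / 4"
    unfolding sum.distrib[symmetric]
    by (intro arg_cong[where f = "\<lambda>x. x / 4"] sum.cong)
      (auto simp: metropolis_weight_commute[of G] power2_eq_square algebra_simps)
  finally show ?thesis .
qed

text \<open>
  Bound \<open>(v\<^sub>i - v\<^sub>j)\<^sup>2\<close> by \<open>2 v\<^sub>i\<^sup>2 + 2 v\<^sub>j\<^sup>2\<close>; the weights of the edges at a vertex sum to at most \<open>1\<close>.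
\<close>

lemma metropolis_laplacian_le_identity:
  assumes v: "v \<in> carrier_vec n"
  shows "v \<bullet> (metropolis_laplacian n G *\<^sub>v v) \<le> v \<bullet> v"
proof -
  let ?w = "metropolis_weight G"
  have row_sum: "(\<Sum>j\<in>neighbors G i. ?w i j) \<le> 1" for i
  proof -
    have "?w i j \<le> 1 / real (card (neighbors G i))" if "j \<in> neighbors G i" for j
    proof -
      have "card (neighbors G i) > 0" using that finite_neighbors by (auto simp: card_gt_0_iff)
      then show ?thesis unfolding metropolis_weight_def by (intro divide_left_mono) auto
    qed
    then have "(\<Sum>j\<in>neighbors G i. ?w i j) \<le> (\<Sum>j\<in>neighbors G i. 1 / real (card (neighbors G i)))"
      by (rule sum_mono)
    then show ?thesis by (cases "card (neighbors G i) = 0") auto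
  qed
  have "(\<Sum>(i, j)\<in>parcs G. ?w i j * (v $ i - v $ j)\<^sup>2)
      \<le> (\<Sum>(i, j)\<in>parcs G. 2 * (?w i j * (v $ i)\<^sup>2) + 2 * (?w j i * (v $ j)\<^sup>2))"
  proof (rule sum_mono, clarify)
    fix i j
    have "0 \<le> (v $ i + v $ j)\<^sup>2" by simp
    then have "(v $ i - v $ j)\<^sup>2 \<le> 2 * ((v $ i)\<^sup>2 + (v $ j)\<^sup>2)"
      by (simp add: power2_eq_square algebra_simps)
    from mult_left_mono[OF this metropolis_weight_nonneg[of G i j]]
    show "?w i j * (v $ i - v $ j)\<^sup>2 \<le> 2 * (?w i j * (v $ i)\<^sup>2) + 2 * (?w j i * (v $ j)\<^sup>2)"
      by (simp add: metropolis_weight_commute[of G j i] algebra_simps)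
  qed
  also have "\<dots> = 4 * (\<Sum>(i, j)\<in>parcs G. ?w i j * (v $ i)\<^sup>2)"
    using sum_sym_relation[OF pair_graph_sym[OF G(1)], of "\<lambda>i j. 2 * (?w i j * (v $ i)\<^sup>2)"]
    by (simp add: case_prod_beta sum.distrib sum_distrib_left[symmetric])
  also have "(\<Sum>(i, j)\<in>parcs G. ?w i j * (v $ i)\<^sup>2) = (\<Sum>i<n. (\<Sum>j\<in>neighbors G i. ?w i j) * (v $ i)\<^sup>2)"
    by (simp add: sum_arcs sum_distrib_right)
  also have "\<dots> \<le> (\<Sum>i<n. 1 * (v $ i)\<^sup>2)"
    by (intro sum_mono mult_right_mono row_sum) simp
  finally show ?thesis
    using v by (simp add: metropolis_laplacian_quadratic_form scalar_prod_self)
qed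

text \<open>
  The coefficients of the quadratic form are \<open>1 / (8 max_degree)\<close>, so the constant \<open>6\<close>
  of the Poincare inequality becomes \<open>48\<close>.
\<close>

lemma metropolis_laplacian_spectral_gap:
  assumes conn: "Digraph_Component.connected (with_proj G)"
    and v: "v \<in> carrier_vec n" and mean: "(\<Sum>i<n. v $ i) = 0"
  shows "v \<bullet> v \<le> 48 * (real n)\<^sup>2 * (v \<bullet> (metropolis_laplacian n G *\<^sub>v v))"
proof -
  have "(\<Sum>i<n. (v $ i)\<^sup>2)
      \<le> 6 * (real n)\<^sup>2 * (\<Sum>(i, j)\<in>parcs G. (v $ i - v $ j)\<^sup>2 / max_degree (parcs G) i j)"
    using poincare_inequality[of "{..<n}" "parcs G" "vec_index v"] mean G
      pair_graph_connected(2)[OF G(1) conn] pair_graph_facts[OF G(1)] by simp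
  also have "(\<Sum>(i, j)\<in>parcs G. (v $ i - v $ j)\<^sup>2 / max_degree (parcs G) i j)
      = (\<Sum>(i, j)\<in>parcs G. 2 * (metropolis_weight G i j * (v $ i - v $ j)\<^sup>2))"
    by (intro sum.cong) (auto simp: metropolis_weight_max_degree)
  also have "\<dots> = 8 * (v \<bullet> (metropolis_laplacian n G *\<^sub>v v))"
    by (simp add: metropolis_laplacian_quadratic_form[OF v] case_prod_beta sum_distrib_left[symmetric])
  finally show ?thesis using v by (simp add: scalar_prod_self)
qed

end

text \<open>
  A maximal independent set of columns has as many elements as the space has dimensions, so it is
  a basis.
\<close>

lemma full_row_rank_surj:
  fixes U :: "real mat"
  assumes U: "U \<in> carrier_mat m n" and rank: "vec_space.rank m U = m" and q: "q \<in> carrier_vec m"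
  shows "\<exists>w\<in>carrier_vec n. U *\<^sub>v w = q"
proof -
  interpret vec_space "TYPE(real)" m .
  have cols: "set (cols U) \<subseteq> carrier_vec m" using U cols_dim by blast
  have "lin_indpt {}" by (simp add: lin_dep_def)
  then obtain S where S: "finite S" "maximal S (\<lambda>T. T \<subseteq> set (cols U) \<and> lin_indpt T)"
    using maximal_exists_superset[of "set (cols U)" "\<lambda>T. T \<subseteq> set (cols U) \<and> lin_indpt T" "{}"] by auto
  have "card S = m" using rank_card_indpt[OF U S(2)] rank by simp
  moreover have "S \<subseteq> set (cols U)" "lin_indpt S" using S(2) by (auto simp: maximal_def)
  ultimately have "basis S"
    using cols S(1) by (intro dim_li_is_basis) (auto simp: dim_is_n)
  then have "carrier_vec m \<subseteq> span (set (cols U))"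
    using span_is_monotone[OF \<open>S \<subseteq> set (cols U)\<close>] by (simp add: basis_def)
  then have "q \<in> col_space U" using q by (auto simp: col_space_def)
  then show ?thesis using U by (auto simp: col_space_eq)
qed

context
  fixes n :: nat and G :: "nat pair_pre_digraph" and U :: "real mat"
  assumes G: "pair_graph G" "pverts G = {..<n}"
    and conn: "Digraph_Component.connected (with_proj G)"
    and factor: "laplacian_factor n (metropolis_laplacian n G) U"
begin

lemma factor_carrier: "U \<in> carrier_mat (n - 1) n"
  using factor by (simp add: laplacian_factor_def)

lemma factor_gram: "metropolis_laplacian n G = U\<^sup>T * U"
  using factor by (simp add: laplacian_factor_def)

lemma factor_quadratic_form:
  assumes v: "v \<in> carrier_vec n"
  shows "v \<bullet> (metropolis_laplacian n G *\<^sub>v v) = (U *\<^sub>v v) \<bullet> (U *\<^sub>v v)"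
proof -
  have "v \<bullet> (metropolis_laplacian n G *\<^sub>v v) = v \<bullet> (U\<^sup>T *\<^sub>v (U *\<^sub>v v))"
    using factor_carrier v by (simp add: factor_gram assoc_mult_mat_vec[of _ n "n - 1" _ n])
  also have "\<dots> = (U\<^sup>T *\<^sub>v (U *\<^sub>v v)) \<bullet> v"
    using factor_carrier v by (intro comm_scalar_prod[of _ n]) auto
  also have "\<dots> = (U *\<^sub>v v) \<bullet> (U *\<^sub>v v)"
    using factor_carrier v by (intro transpose_vec_mult_scalar) auto
  finally show ?thesis .
qed

lemma factor_contraction:
  assumes v: "v \<in> carrier_vec n"
  shows "(U *\<^sub>v v) \<bullet> (U *\<^sub>v v) \<le> v \<bullet> v"
  using metropolis_laplacian_le_identity[OF G v] factor_quadratic_form[OF v] by simp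

lemma factor_const: "U *\<^sub>v (vec n (\<lambda>_. a)) = 0\<^sub>v (n - 1)"
proof -
  have "vec n (\<lambda>_. a) = a \<cdot>\<^sub>v vec n (\<lambda>_. 1)" by (intro eq_vecI) auto
  then have "vec n (\<lambda>_. a) \<in> mat_kernel U" using factor by (auto simp: laplacian_factor_def)
  then show ?thesis using mat_kernelD[OF factor_carrier] by simp
qed

text \<open>
  A lower bound for the spectrum of \<open>U U\<^sup>T\<close>, whose eigenvalues are the nonzero ones of \<open>U\<^sup>T U\<close>. The
  spectral decomposition is avoided by writing \<open>q = U w\<close> with \<open>w\<close> of mean zero:
  \<open>|q|\<^sup>4 = \<langle>U\<^sup>T q, w\<rangle>\<^sup>2 \<le> |U\<^sup>T q|\<^sup>2 |w|\<^sup>2\<close>, and the spectral gap bounds \<open>|w|\<^sup>2\<close> by \<open>|U w|\<^sup>2 = |q|\<^sup>2\<close>.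
\<close>

lemma factor_transpose_lower_bound:
  assumes q: "q \<in> carrier_vec (n - 1)"
  shows "q \<bullet> q \<le> 48 * (real n)\<^sup>2 * ((U\<^sup>T *\<^sub>v q) \<bullet> (U\<^sup>T *\<^sub>v q))"
proof -
  have n: "n > 0" using pair_graph_connected(1)[OF G(1) conn] G(2) by auto
  have "vec_space.rank (n - 1) U = n - 1" using factor by (simp add: laplacian_factor_def)
  then obtain w0 where w0: "w0 \<in> carrier_vec n" "U *\<^sub>v w0 = q"
    using full_row_rank_surj[OF factor_carrier _ q] by blast
  define a where "a = - (\<Sum>i<n. w0 $ i) / real n"
  \<comment> \<open>Constant vectors lie in the kernel, so the preimage may be shifted to mean zero.\<close>
  define w where "w = w0 + vec n (\<lambda>_. a)"
  have w: "w \<in> carrier_vec n" using w0 by (simp add: w_def)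
  have Uw: "U *\<^sub>v w = q"
    using mult_add_distrib_mat_vec[OF factor_carrier w0(1), of "vec n (\<lambda>_. a)"] w0 q
    by (simp add: w_def factor_const)
  have "(\<Sum>i<n. w $ i) = 0"
    using w0 n by (simp add: w_def a_def sum.distrib sum_subtractf)
  from metropolis_laplacian_spectral_gap[OF G conn w this]
  have gap: "w \<bullet> w \<le> 48 * (real n)\<^sup>2 * (q \<bullet> q)"
    by (simp add: factor_quadratic_form[OF w] Uw)
  have "q \<bullet> q = (U\<^sup>T *\<^sub>v q) \<bullet> w"
    using transpose_vec_mult_scalar[OF factor_carrier w q] Uw by simp
  then have "(q \<bullet> q)\<^sup>2 \<le> ((U\<^sup>T *\<^sub>v q) \<bullet> (U\<^sup>T *\<^sub>v q)) * (w \<bullet> w)"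
    using Cauchy_Schwarz_vec[of "U\<^sup>T *\<^sub>v q" w] factor_carrier w by simp
  also have "\<dots> \<le> ((U\<^sup>T *\<^sub>v q) \<bullet> (U\<^sup>T *\<^sub>v q)) * (48 * (real n)\<^sup>2 * (q \<bullet> q))"
    by (intro mult_left_mono gap) simp
  finally have square: "(q \<bullet> q) * (q \<bullet> q)
      \<le> (48 * (real n)\<^sup>2 * ((U\<^sup>T *\<^sub>v q) \<bullet> (U\<^sup>T *\<^sub>v q))) * (q \<bullet> q)"
    by (simp only: power2_eq_square mult_ac)
  show ?thesis
  proof (cases "q \<bullet> q = 0")
    case False
    then have "0 < q \<bullet> q" by (metis less_le scalar_prod_self_nonneg)
    with square show ?thesis by (rule mult_right_le_imp_le)
  next
    case True
    show ?thesis unfolding True by simp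
  qed
qed

lemma factor_frob_contraction:
  assumes A: "A \<in> carrier_mat n p"
  shows "frob (U * A) (U * A) \<le> frob A A"
proof -
  have "frob (U * A) (U * A) = (\<Sum>j<p. (U *\<^sub>v col A j) \<bullet> (U *\<^sub>v col A j))"
    using factor_carrier A by (simp add: frob_cols[of _ "n - 1" p] del: col_mult)
  also have "\<dots> \<le> (\<Sum>j<p. col A j \<bullet> col A j)"
    using A by (intro sum_mono factor_contraction) auto
  finally show ?thesis using A by (simp add: frob_cols[of _ n p])
qed

lemma factor_frob_transpose_lower_bound:
  assumes Q: "Q \<in> carrier_mat (n - 1) p"
  shows "frob Q Q \<le> 48 * (real n)\<^sup>2 * frob (U\<^sup>T * Q) (U\<^sup>T * Q)"
proof -
  have "frob Q Q = (\<Sum>j<p. col Q j \<bullet> col Q j)"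
    using Q by (simp add: frob_cols[of _ "n - 1" p])
  also have "\<dots> \<le> (\<Sum>j<p. 48 * (real n)\<^sup>2 * ((U\<^sup>T *\<^sub>v col Q j) \<bullet> (U\<^sup>T *\<^sub>v col Q j)))"
    using Q by (intro sum_mono factor_transpose_lower_bound) auto
  also have "\<dots> = 48 * (real n)\<^sup>2 * frob (U\<^sup>T * Q) (U\<^sup>T * Q)"
    using factor_carrier Q by (simp add: frob_cols[of _ n p] sum_distrib_left del: col_mult)
  finally show ?thesis .
qed

lemma factor_mult_equal_rows:
  assumes A: "A \<in> carrier_mat n p" and eq: "\<And>i j. i < n \<Longrightarrow> j < n \<Longrightarrow> row A i = row A j"
  shows "U * A = 0\<^sub>m (n - 1) p"
proof (rule eq_matI)
  fix i j assume "i < dim_row (0\<^sub>m (n - 1) p :: real mat)" "j < dim_col (0\<^sub>m (n - 1) p :: real mat)"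
  then have i: "i < n - 1" and j: "j < p" by auto
  have const: "A $$ (k, j) = A $$ (0, j)" if "k < n" for k
  proof -
    have "row A k $ j = row A 0 $ j" using eq[of k 0] that by simp
    then show ?thesis using A j that by simp
  qed
  have "col A j = vec n (\<lambda>_. A $$ (0, j))"
  proof (rule eq_vecI)
    fix k assume "k < dim_vec (vec n (\<lambda>_. A $$ (0, j)))"
    then have "k < n" by simp
    from const[OF this] show "col A j $ k = vec n (\<lambda>_. A $$ (0, j)) $ k"
      using A j \<open>k < n\<close> by simp
  qed (use A in simp)
  then have "col (U * A) j = 0\<^sub>v (n - 1)"
    using factor_carrier A j by (simp add: factor_const del: col_mult)
  then have "col (U * A) j $ i = 0" using i by simp
  then show "(U * A) $$ (i, j) = 0\<^sub>m (n - 1) p $$ (i, j)"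
    using factor_carrier A i j by simp
qed (use factor_carrier A in auto)

end

section \<open>The Lyapunov function\<close>

text \<open>
  The squared norm given by the block matrix with blocks \<open>c I\<close> and \<open>c (I - U\<^sup>T U)\<close>, evaluated at
  the pair of the dual error \<open>Q\<close> and the gradient error \<open>A\<close>.
\<close>

definition lyapunov :: "real \<Rightarrow> real mat \<Rightarrow> real mat \<Rightarrow> real mat \<Rightarrow> real" where
  "lyapunov c U Q A = c * frob Q Q + c * (frob A A - frob (U * A) (U * A))"

text \<open>
  Expanding \<open>0 \<le> |W - U U\<^sup>T W|\<^sup>2\<close> and applying the contraction hypothesis to \<open>U\<^sup>T W\<close> gives the
  contraction property of the transpose.
\<close>

lemma transpose_contraction_on_range:
  assumes U: "U \<in> carrier_mat m n" and W: "W \<in> carrier_mat m p"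
    and contr: "\<And>A. A \<in> carrier_mat n p \<Longrightarrow> frob (U * A) (U * A) \<le> frob A A"
  shows "frob (U\<^sup>T * W) (U\<^sup>T * W) \<le> frob W W"
proof -
  define H where "H = U\<^sup>T * W"
  have H: "H \<in> carrier_mat n p" using U W by (simp add: H_def)
  have UH: "U * H \<in> carrier_mat m p" using U H by simp
  have "frob (U * H) W = frob H H"
    using U W H by (simp add: frob_mult_left H_def)
  moreover have "frob W (U * H) = frob (U * H) W"
    using W UH by (intro frob_commute) auto
  moreover have "0 \<le> frob (W - U * H) (W - U * H)" by simp
  ultimately have "0 \<le> frob W W - 2 * frob H H + frob (U * H) (U * H)"
    using U H W by (simp add: frob_minus_left frob_minus_right)
  with contr[OF H] show ?thesis by (simp add: H_def)
qed

text \<open>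
  The pair \<open>(Q, A)\<close> is the error after a step and the pair \<open>(Q - U * A, A - D)\<close> the error before it.
  The matrix paired with \<open>A\<close> is the primal error after the step.
\<close>

lemma lyapunov_step_identity:
  assumes U: "U \<in> carrier_mat m n" and Q: "Q \<in> carrier_mat m p"
    and A: "A \<in> carrier_mat n p" and D: "D \<in> carrier_mat n p"
  shows "lyapunov c U (Q - U * A) (A - D) = lyapunov c U Q A + lyapunov c U (U * A) D
    + 2 * frob A ((- c) \<cdot>\<^sub>m (U\<^sup>T * Q + (D - U\<^sup>T * (U * D))))"
proof -
  have UA: "U * A \<in> carrier_mat m p" and UD: "U * D \<in> carrier_mat m p"
    using U A D by auto
  have "U * (A - D) = U * A - U * D" using mult_minus_distrib_mat[OF U A D] .
  moreover have "frob Q (U * A) = frob (U * A) Q" "frob D A = frob A D"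
    "frob (U * D) (U * A) = frob (U * A) (U * D)"
    using Q UA A D UD by (auto intro!: frob_commute)
  moreover have "frob A (U\<^sup>T * Q) = frob (U * A) Q" "frob A (U\<^sup>T * (U * D)) = frob (U * A) (U * D)"
    using U A Q D by (simp_all add: frob_mult_left)
  ultimately show ?thesis
    using U Q A D unfolding lyapunov_def
    by (simp add: frob_minus_left frob_minus_right frob_add_right frob_smult_right minus_carrier_mat
        algebra_simps)
qed

text \<open>
  By the step identity it suffices to bound \<open>V(Q, A)\<close> by \<open>T\<close> times the decrease. The gradient part
  is bounded through cocoercivity. For the dual part, \<open>c\<^sup>2 |U\<^sup>T Q|\<^sup>2\<close> is bounded through the formula
  for \<open>E\<close> by \<open>2 |E|\<^sup>2 + 2 c\<^sup>2 |D - U\<^sup>T U D|\<^sup>2\<close>, where the first summand is absorbed by strong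
  convexity and the second by \<open>V(U A, D)\<close>; the gap then passes from \<open>U\<^sup>T Q\<close> to \<open>Q\<close>.
\<close>

lemma lyapunov_contraction:
  assumes U: "U \<in> carrier_mat m n" and Q: "Q \<in> carrier_mat m p"
    and A: "A \<in> carrier_mat n p" and D: "D \<in> carrier_mat n p"
    and c: "0 < c" and mu: "0 < \<mu>" and K: "0 \<le> K"
    and contr: "\<And>A. A \<in> carrier_mat n p \<Longrightarrow> frob (U * A) (U * A) \<le> frob A A"
    and gap: "frob Q Q \<le> K * frob (U\<^sup>T * Q) (U\<^sup>T * Q)"
    and E: "E = (- c) \<cdot>\<^sub>m (U\<^sup>T * Q + (D - U\<^sup>T * (U * D)))"
    and strong: "\<mu> * frob E E \<le> frob A E"
    and coco: "frob A A \<le> l * frob A E"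
    and T: "2 * K \<le> T" "c * l + 2 * K / (c * \<mu>) \<le> 2 * T"
  shows "(1 + T) * lyapunov c U Q A \<le> T * lyapunov c U (Q - U * A) (A - D)"
proof -
  define H where "H = U\<^sup>T * Q"
  define W where "W = U * D"
  define r where "r = D - U\<^sup>T * W"
  have H: "H \<in> carrier_mat n p" and W: "W \<in> carrier_mat m p"
    and UW: "U\<^sup>T * W \<in> carrier_mat n p"
    using U Q D by (auto simp: H_def W_def)
  have r: "r \<in> carrier_mat n p" using UW by (simp add: r_def minus_carrier_mat)
  define \<delta> where "\<delta> = frob D D - frob W W"
  have \<delta>: "0 \<le> \<delta>" using contr[OF D] by (simp add: \<delta>_def W_def)
  have AE: "0 \<le> frob A E"
    by (rule order_trans[OF _ strong]) (use mu in simp)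
  have r_le: "frob r r \<le> \<delta>"
  proof -
    have "frob D (U\<^sup>T * W) = frob W W" using U D W by (simp add: frob_mult_left[symmetric] W_def)
    moreover have "frob (U\<^sup>T * W) D = frob D (U\<^sup>T * W)" using D UW by (intro frob_commute) auto
    ultimately have "frob r r = frob D D - 2 * frob W W + frob (U\<^sup>T * W) (U\<^sup>T * W)"
      unfolding r_def using U W D by (simp add: frob_minus_left frob_minus_right)
    then show ?thesis
      using transpose_contraction_on_range[OF U W contr] by (simp add: \<delta>_def)
  qed
  \<comment> \<open>The difference of the two sides is the squared norm of \<open>H + 2 r\<close>.\<close>
  have "frob H H \<le> 2 * frob (H + r) (H + r) + 2 * frob r r"
  proof -
    have "0 \<le> frob (H + 2 \<cdot>\<^sub>m r) (H + 2 \<cdot>\<^sub>m r)" by simp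
    moreover have "frob r H = frob H r" using r H by (intro frob_commute) auto
    ultimately show ?thesis
      using H r by (simp add: frob_add_left frob_add_right frob_smult_left frob_smult_right)
  qed
  moreover have "frob E E = c\<^sup>2 * frob (H + r) (H + r)"
    unfolding E H_def[symmetric] W_def[symmetric] r_def[symmetric]
    using H r by (simp add: frob_smult_left frob_smult_right power2_eq_square)
  ultimately have "c\<^sup>2 * frob H H \<le> 2 * frob E E + 2 * c\<^sup>2 * frob r r"
    using c mult_left_mono[of "frob H H" "2 * frob (H + r) (H + r) + 2 * frob r r" "c\<^sup>2"]
    by (simp add: algebra_simps)
  also have "\<dots> \<le> 2 * (frob A E / \<mu>) + 2 * c\<^sup>2 * \<delta>"
    using strong mu r_le by (intro add_mono mult_left_mono) (auto simp: field_simps)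
  finally have HH: "c\<^sup>2 * frob H H \<le> 2 * (frob A E / \<mu>) + 2 * c\<^sup>2 * \<delta>" .
  have "c * frob Q Q \<le> c * (K * frob H H)"
    using gap c by (simp add: H_def)
  also have "\<dots> = K / c * (c\<^sup>2 * frob H H)"
    using c by (simp add: power2_eq_square)
  also have "\<dots> \<le> K / c * (2 * (frob A E / \<mu>) + 2 * c\<^sup>2 * \<delta>)"
    using K c by (intro mult_left_mono HH) simp
  also have "\<dots> = 2 * K / (c * \<mu>) * frob A E + 2 * K * (c * \<delta>)"
    using c mu by (simp add: field_simps power2_eq_square)
  finally have dual: "c * frob Q Q \<le> 2 * K / (c * \<mu>) * frob A E + 2 * K * (c * \<delta>)" .
  have "c * frob A A \<le> c * (l * frob A E)" using coco c by simp
  moreover have "lyapunov c U Q A \<le> c * frob Q Q + c * frob A A"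
    using c by (simp add: lyapunov_def)
  ultimately have "lyapunov c U Q A \<le> (c * l + 2 * K / (c * \<mu>)) * frob A E + 2 * K * (c * \<delta>)"
    using dual by (simp add: algebra_simps)
  also have "\<dots> \<le> 2 * T * frob A E + T * (c * \<delta>)"
    using T AE c \<delta> by (intro add_mono mult_right_mono) auto
  also have "\<dots> \<le> T * (lyapunov c U (U * A) D + 2 * frob A E)"
  proof -
    have "0 \<le> T" using T K by linarith
    moreover have "c * \<delta> \<le> lyapunov c U (U * A) D"
      using c by (simp add: lyapunov_def \<delta>_def W_def)
    ultimately have "T * (c * \<delta>) \<le> T * lyapunov c U (U * A) D" by (intro mult_left_mono)
    then show ?thesis by (simp add: algebra_simps)
  qed
  finally show ?thesis
    unfolding lyapunov_step_identity[OF U Q A D] E[symmetric] by (simp add: algebra_simps)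
qed

lemma frob_append_rows:
  assumes A: "A \<in> carrier_mat m p" "A' \<in> carrier_mat m p"
    and B: "B \<in> carrier_mat n p" "B' \<in> carrier_mat n p"
  shows "frob (A @\<^sub>r B) (A' @\<^sub>r B') = frob A A' + frob B B'"
proof -
  have col: "col (A @\<^sub>r B) j = col A j @\<^sub>v col B j"
    if "j < p" "A \<in> carrier_mat m p" "B \<in> carrier_mat n p" for j and A B :: "real mat"
    unfolding append_rows_def using that
    by (intro col_four_block_mat[of _ m p _ 0 _ n]) auto
  have "col (A @\<^sub>r B) j \<bullet> col (A' @\<^sub>r B') j = col A j \<bullet> col A' j + col B j \<bullet> col B' j" if "j < p" for j
    using that A B by (simp add: col) (intro scalar_prod_append[of _ m _ n]; simp)
  then show ?thesis
    using A B by (simp add: frob_cols[of _ "m + n" p] frob_cols[of _ m p] frob_cols[of _ n p] sum.distrib)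
qed

lemma append_rows_minus:
  fixes A :: "real mat"
  assumes "A \<in> carrier_mat m p" "A' \<in> carrier_mat m p" "B \<in> carrier_mat n p" "B' \<in> carrier_mat n p"
  shows "(A @\<^sub>r B) - (A' @\<^sub>r B') = (A - A') @\<^sub>r (B - B')"
  using assms by (intro eq_matI) (auto simp: append_rows_def)

text \<open>
  The last hypothesis makes the quadratic form nonnegative, so that squaring undoes the square root
  in \<open>mat_norm\<close>.
\<close>

lemma mirror_norm_eq_lyapunov:
  assumes U: "U \<in> carrier_mat (n - 1) n" and Q: "Q \<in> carrier_mat (n - 1) p"
    and A: "A \<in> carrier_mat n p" and c: "0 < c" and \<beta>: "\<And>i. i < n \<Longrightarrow> \<beta> i = c"
    and contr: "frob (U * A) (U * A) \<le> frob A A"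
  shows "(mat_norm (mirror_M n (U\<^sup>T * U) \<beta> c) (Q @\<^sub>r A))\<^sup>2 = lyapunov c U Q A"
proof -
  define m where "m = n - 1"
  note U = U[folded m_def] and Q = Q[folded m_def]
  define M where "M = mirror_M n (U\<^sup>T * U) \<beta> c"
  have block: "mat_diag n \<beta> - c \<cdot>\<^sub>m (U\<^sup>T * U) = c \<cdot>\<^sub>m (1\<^sub>m n - U\<^sup>T * U)"
    using U \<beta> by (intro eq_matI) (auto simp: mat_diag_def algebra_simps)
  have P: "c \<cdot>\<^sub>m (1\<^sub>m n - U\<^sup>T * U) \<in> carrier_mat n n" using U by (simp add: minus_carrier_mat)
  have M: "M \<in> carrier_mat (m + n) (m + n)"
    unfolding M_def mirror_M_def block m_def[symmetric] by (intro four_block_carrier_mat P) auto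
  have z: "Q @\<^sub>r A \<in> carrier_mat (m + n) p" using Q A by simp
  have PA: "c \<cdot>\<^sub>m (1\<^sub>m n - U\<^sup>T * U) * A = c \<cdot>\<^sub>m (A - U\<^sup>T * (U * A))"
  proof -
    have "(1\<^sub>m n - U\<^sup>T * U) * A = A - U\<^sup>T * U * A"
      using minus_mult_distrib_mat[of "1\<^sub>m n" n n "U\<^sup>T * U" A p] U A by simp
    moreover have "U\<^sup>T * U * A = U\<^sup>T * (U * A)" using U A by (intro assoc_mult_mat) auto
    ultimately show ?thesis
      using mult_smult_assoc_mat[of "1\<^sub>m n - U\<^sup>T * U" n n A p c] U A by (simp add: minus_carrier_mat)
  qed
  have Mz: "M * (Q @\<^sub>r A) = (c \<cdot>\<^sub>m Q) @\<^sub>r (c \<cdot>\<^sub>m (A - U\<^sup>T * (U * A)))"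
  proof -
    have dims: "dim_row Q = m" "dim_row A = n" using Q A by auto
    have "M * (Q @\<^sub>r A) = four_block_mat
        (c \<cdot>\<^sub>m 1\<^sub>m m * Q + 0\<^sub>m m n * A) (c \<cdot>\<^sub>m 1\<^sub>m m * 0\<^sub>m m 0 + 0\<^sub>m m n * 0\<^sub>m n 0)
        (0\<^sub>m n m * Q + c \<cdot>\<^sub>m (1\<^sub>m n - U\<^sup>T * U) * A) (0\<^sub>m n m * 0\<^sub>m m 0 + c \<cdot>\<^sub>m (1\<^sub>m n - U\<^sup>T * U) * 0\<^sub>m n 0)"
      unfolding M_def mirror_M_def append_rows_def block m_def[symmetric] dims
      by (rule mult_four_block_mat[OF _ _ _ P Q _ A]) auto
    also have "\<dots> = (c \<cdot>\<^sub>m Q) @\<^sub>r (c \<cdot>\<^sub>m (A - U\<^sup>T * (U * A)))"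
      unfolding append_rows_def PA using U Q A
      by (intro cong_four_block_mat) (auto simp: minus_carrier_mat mult_smult_assoc_mat[of _ m m _ p])
    finally show ?thesis .
  qed
  have "mat_trace ((Q @\<^sub>r A)\<^sup>T * M * (Q @\<^sub>r A)) = frob (Q @\<^sub>r A) (M * (Q @\<^sub>r A))"
  proof -
    have "(Q @\<^sub>r A)\<^sup>T * M * (Q @\<^sub>r A) = (Q @\<^sub>r A)\<^sup>T * (M * (Q @\<^sub>r A))"
      using z M by (intro assoc_mult_mat[of _ p "m + n" _ "m + n" _ p]) auto
    then show ?thesis using z M by (simp add: mat_trace_transpose_mult)
  qed
  also have "\<dots> = frob Q (c \<cdot>\<^sub>m Q) + frob A (c \<cdot>\<^sub>m (A - U\<^sup>T * (U * A)))"
    unfolding Mz using U Q A by (intro frob_append_rows[of _ m p _ _ n]) (auto simp: minus_carrier_mat)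
  also have "\<dots> = lyapunov c U Q A"
    using U Q A by (simp add: lyapunov_def frob_smult_right frob_minus_right frob_mult_left)
  finally have trace: "mat_trace ((Q @\<^sub>r A)\<^sup>T * M * (Q @\<^sub>r A)) = lyapunov c U Q A" .
  have "0 \<le> lyapunov c U Q A" using c contr by (simp add: lyapunov_def)
  then show ?thesis by (simp add: mat_norm_def M_def[symmetric] trace)
qed

section \<open>Mirror-P-EXTRA as a proximal point iteration\<close>

lemma mirror_q_carrier:
  assumes "U \<in> carrier_mat (n - 1) n" "\<And>k. g k \<in> carrier_mat n p"
  shows "mirror_q n p U g k \<in> carrier_mat (n - 1) p"
  using assms by (induction k) (auto intro!: add_carrier_mat mult_carrier_mat)

context
  fixes n p :: nat and G :: "nat pair_pre_digraph" and f :: "nat \<Rightarrow> real vec \<Rightarrow> real"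
    and R U :: "real mat" and c :: real and \<beta> :: "nat \<Rightarrow> real" and X S Y :: "nat \<Rightarrow> real mat"
  assumes G: "pair_graph G" "pverts G = {..<n}"
    and conn: "Digraph_Component.connected (with_proj G)"
    and factor: "laplacian_factor n (metropolis_laplacian n G) U"
    and diff: "\<And>i. i < n \<Longrightarrow> differentiable_vec p (f i)"
    and R: "R \<in> carrier_mat n p" and c: "0 < c" and \<beta>: "\<And>i. i < n \<Longrightarrow> \<beta> i = c"
    and alg: "mirror_p_extra n p G (metropolis_laplacian n G) f R \<beta> c X S Y"
begin

lemma iterate_carrier:
  "X k \<in> carrier_mat n p" "S k \<in> carrier_mat n p" "Y k \<in> carrier_mat n p"
  using alg by (simp_all add: mirror_p_extra_def)

lemma iterate_carrier_dims:
  "dim_row (X k) = n" "dim_col (X k) = p" "dim_row (S k) = n" "dim_col (S k) = p"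
  "dim_row (Y k) = n" "dim_col (Y k) = p"
  using iterate_carrier[of k] by auto

lemma U_carrier: "U \<in> carrier_mat (n - 1) n"
  by (rule factor_carrier[OF G conn factor])

abbreviation grads :: "nat \<Rightarrow> real mat" where
  "grads k \<equiv> stacked_gradient n p f (X k)"

abbreviation dual :: "nat \<Rightarrow> real mat" where
  "dual k \<equiv> mirror_q n p U grads k"

lemma dual_carrier: "dual k \<in> carrier_mat (n - 1) p"
  by (rule mirror_q_carrier[OF U_carrier]) simp

definition prox_shift :: "nat \<Rightarrow> nat \<Rightarrow> real vec" where
  "prox_shift k i = - row R i + (2 * c) \<cdot>\<^sub>v row (Y (Suc k)) i - c \<cdot>\<^sub>v row (Y k) i"

lemma algorithm_step:
  assumes "i < n"
  shows "row (Y (Suc k)) i = row (Y k) i +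
      finsum_vec TYPE(real) p (\<lambda>j. metropolis_laplacian n G $$ (i, j) \<cdot>\<^sub>v row (S k) j)
        (insert i (neighbors G i))"
    and "is_arg_min (\<lambda>v. f i v - row (S k) i \<bullet> v + 1 / (2 * c) * (vnorm (v + prox_shift k i))\<^sup>2)
      (\<lambda>v. v \<in> carrier_vec p) (row (X (Suc k)) i)"
    and "row (S (Suc k)) i = row (S k) i - (1 / c) \<cdot>\<^sub>v (row (X (Suc k)) i + prox_shift k i)"
proof -
  note step = alg[unfolded mirror_p_extra_def Let_def, THEN conjunct2, THEN conjunct2,
      THEN spec[of _ k], THEN spec[of _ i], THEN mp, OF assms, unfolded \<beta>[OF assms],
      folded prox_shift_def]
  show "row (Y (Suc k)) i = row (Y k) i +
      finsum_vec TYPE(real) p (\<lambda>j. metropolis_laplacian n G $$ (i, j) \<cdot>\<^sub>v row (S k) j)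
        (insert i (neighbors G i))"
    and "is_arg_min (\<lambda>v. f i v - row (S k) i \<bullet> v + 1 / (2 * c) * (vnorm (v + prox_shift k i))\<^sup>2)
      (\<lambda>v. v \<in> carrier_vec p) (row (X (Suc k)) i)"
    and "row (S (Suc k)) i = row (S k) i - (1 / c) \<cdot>\<^sub>v (row (X (Suc k)) i + prox_shift k i)"
    using step by blast+
qed

lemma prox_shift_carrier: "i < n \<Longrightarrow> prox_shift k i \<in> carrier_vec p"
  using iterate_carrier R by (auto simp: prox_shift_def)

text \<open>
  The mirror variable is initialised as the gradient, and the proximal step keeps it so.
\<close>

lemma S_eq_grads: "S k = grads k"
proof (rule eq_rowI)
  fix i assume "i < dim_row (grads k)"
  then have i: "i < n" by simp
  have "row (S k) i = gradient p (f i) (row (X k) i)"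
  proof (cases k)
    case 0
    then show ?thesis using alg i by (simp add: mirror_p_extra_def)
  next
    case (Suc j)
    have x: "row (X (Suc j)) i \<in> carrier_vec p" and s: "row (S j) i \<in> carrier_vec p"
      using iterate_carrier i by auto
    have "gradient p (f i) (row (X (Suc j)) i)
        = row (S j) i - (1 / c) \<cdot>\<^sub>v (row (X (Suc j)) i + prox_shift j i)"
      using proximal_step_gradient[OF algorithm_step(2)[OF i]
          has_gradient_gradient[OF diff[OF i] x] s prox_shift_carrier[OF i]] c by simp
    then show ?thesis using algorithm_step(3)[OF i] Suc by simp
  qed
  then show "row (S k) i = row (grads k) i"
    using iterate_carrier(1) i diff by (simp add: row_stacked_gradient)
qed (use iterate_carrier(2) in auto)

lemma Y_step: "Y (Suc k) = Y k + metropolis_laplacian n G * S k"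
proof (rule eq_matI)
  let ?L = "metropolis_laplacian n G"
  have L: "?L \<in> carrier_mat n n" by simp
  fix i m assume "i < dim_row (Y k + ?L * S k)" "m < dim_col (Y k + ?L * S k)"
  then have i: "i < n" and m: "m < p"
    using carrier_matD[OF iterate_carrier(2)[of k]] carrier_matD[OF L] by auto
  have sub: "insert i (neighbors G i) \<subseteq> {..<n}" using i neighbors_less[OF G] by auto
  have "finsum_vec TYPE(real) p (\<lambda>j. ?L $$ (i, j) \<cdot>\<^sub>v row (S k) j) (insert i (neighbors G i)) $ m
      = (\<Sum>j\<in>insert i (neighbors G i). (?L $$ (i, j) \<cdot>\<^sub>v row (S k) j) $ m)"
    using sub m iterate_carrier(2)
    by (intro index_finsum_vec) (auto intro!: smult_carrier_vec simp: finite_neighbors[OF G])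
  also have "\<dots> = (\<Sum>j\<in>insert i (neighbors G i). ?L $$ (i, j) * S k $$ (j, m))"
    using sub m by (intro sum.cong) (auto simp: iterate_carrier_dims subset_iff)
  also have "\<dots> = (\<Sum>j<n. ?L $$ (i, j) * S k $$ (j, m))"
    using sub i by (intro sum.mono_neutral_left) (auto simp: metropolis_laplacian_index[OF G])
  also have "\<dots> = (?L * S k) $$ (i, m)"
    using i m carrier_matD[OF L] by (simp add: scalar_prod_def atLeast0LessThan iterate_carrier_dims)
  finally have sum: "finsum_vec TYPE(real) p (\<lambda>j. ?L $$ (i, j) \<cdot>\<^sub>v row (S k) j)
      (insert i (neighbors G i)) $ m = (?L * S k) $$ (i, m)" .
  have "finsum_vec TYPE(real) p (\<lambda>j. ?L $$ (i, j) \<cdot>\<^sub>v row (S k) j) (insert i (neighbors G i))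
      \<in> carrier_vec p"
    using sub iterate_carrier(2) by (intro finsum_vec_closed) auto
  then have "row (Y (Suc k)) i $ m = row (Y k) i $ m + (?L * S k) $$ (i, m)"
    unfolding algorithm_step(1)[OF i] using m by (simp add: sum)
  then show "Y (Suc k) $$ (i, m) = (Y k + ?L * S k) $$ (i, m)"
    using i m carrier_matD[OF L] by (simp add: iterate_carrier_dims)
qed (simp_all add: iterate_carrier_dims carrier_matD[OF metropolis_laplacian_carrier])

text \<open>
  Recall the index shift: \<open>Y k\<close> and \<open>dual k\<close> both stand for the iterates with index \<open>k - 1\<close>.
\<close>

lemma Y_eq_dual: "Y k = U\<^sup>T * dual k"
proof (induction k)
  case 0
  have "Y 0 = 0\<^sub>m n p"
  proof (rule eq_rowI)
    fix i assume "i < dim_row (0\<^sub>m n p :: real mat)"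
    then show "row (Y 0) i = row (0\<^sub>m n p) i" using alg by (simp add: mirror_p_extra_def)
  qed (use iterate_carrier in auto)
  then show ?case using U_carrier by simp
next
  case (Suc k)
  have g: "grads k \<in> carrier_mat n p" by simp
  have "Y (Suc k) = U\<^sup>T * dual k + U\<^sup>T * U * grads k"
    by (simp add: Y_step Suc S_eq_grads factor_gram[OF G conn factor])
  also have "U\<^sup>T * U * grads k = U\<^sup>T * (U * grads k)"
    using U_carrier g by (intro assoc_mult_mat) auto
  also have "U\<^sup>T * dual k + U\<^sup>T * (U * grads k) = U\<^sup>T * dual (Suc k)"
    using mult_add_distrib_mat[of "U\<^sup>T" n "n - 1" "dual k" p "U * grads k"] U_carrier dual_carrier
      mult_carrier_mat[OF U_carrier g] by simp
  finally show ?case .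
qed

lemma primal_step:
  "X (Suc k) - R = (- c) \<cdot>\<^sub>m (2 \<cdot>\<^sub>m Y (Suc k) - Y k + (grads (Suc k) - grads k))"
proof (rule eq_matI)
  fix i m assume "i < dim_row ((- c) \<cdot>\<^sub>m (2 \<cdot>\<^sub>m Y (Suc k) - Y k + (grads (Suc k) - grads k)))"
    "m < dim_col ((- c) \<cdot>\<^sub>m (2 \<cdot>\<^sub>m Y (Suc k) - Y k + (grads (Suc k) - grads k)))"
  then have i: "i < n" and m: "m < p" by simp_all
  have "row (grads (Suc k)) i $ m
      = (row (grads k) i - (1 / c) \<cdot>\<^sub>v (row (X (Suc k)) i + prox_shift k i)) $ m"
    using algorithm_step(3)[OF i, of k] by (simp add: S_eq_grads)
  then have "grads (Suc k) $$ (i, m) = grads k $$ (i, m)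
      - (1 / c) * (X (Suc k) $$ (i, m) - R $$ (i, m) + 2 * c * Y (Suc k) $$ (i, m) - c * Y k $$ (i, m))"
    using i m iterate_carrier_dims R by (simp add: prox_shift_def algebra_simps)
  then have "X (Suc k) $$ (i, m) - R $$ (i, m)
      = - c * (2 * Y (Suc k) $$ (i, m) - Y k $$ (i, m) + (grads (Suc k) $$ (i, m) - grads k $$ (i, m)))"
    using c by (simp add: field_simps)
  then show "(X (Suc k) - R) $$ (i, m)
      = ((- c) \<cdot>\<^sub>m (2 \<cdot>\<^sub>m Y (Suc k) - Y k + (grads (Suc k) - grads k))) $$ (i, m)"
    using i m iterate_carrier_dims R by simp
qed (use iterate_carrier R in auto)

text \<open>
  In \<open>2 y\<^sup>k - y\<^sup>k\<^sup>-\<^sup>1\<close> the extrapolation \<open>U\<^sup>T (2 q\<^sup>k - q\<^sup>k\<^sup>-\<^sup>1) = U\<^sup>T (q\<^sup>k\<^sup>+\<^sup>1 - U (g\<^sup>k\<^sup>+\<^sup>1 - g\<^sup>k))\<close> trades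
  the old dual variable for the new one, which makes the step implicit in \<open>q\<close>. Subtracting the
  optimality condition for \<open>xopt\<close> leaves an identity between errors.
\<close>

lemma error_recursion:
  assumes xopt: "xopt \<in> carrier_mat n p" and qopt: "qopt \<in> carrier_mat (n - 1) p"
    and kkt: "xopt - R + c \<cdot>\<^sub>m (U\<^sup>T * qopt) = 0\<^sub>m n p"
  shows "X (Suc k) - xopt = (- c) \<cdot>\<^sub>m (U\<^sup>T * (dual (Suc (Suc k)) - qopt)
    + (grads (Suc k) - grads k - U\<^sup>T * (U * (grads (Suc k) - grads k))))"
proof -
  have g: "grads j \<in> carrier_mat n p" for j by simp
  have d: "grads (Suc k) - grads k \<in> carrier_mat n p" by (simp add: minus_carrier_mat)
  have UT: "U\<^sup>T \<in> carrier_mat n (n - 1)" using U_carrier by simp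
  have Ug: "U * grads j \<in> carrier_mat (n - 1) p" for j using U_carrier g by simp
  define a b q x r :: "real mat" where "a = U\<^sup>T * (U * grads k)" and "b = U\<^sup>T * (U * grads (Suc k))"
    and "q = U\<^sup>T * dual k" and "x = U\<^sup>T * qopt" and "r = grads (Suc k) - grads k"
  have carr: "a \<in> carrier_mat n p" "b \<in> carrier_mat n p" "q \<in> carrier_mat n p" "x \<in> carrier_mat n p"
    "r \<in> carrier_mat n p"
    using UT Ug dual_carrier qopt d by (auto simp: a_def b_def q_def x_def r_def)
  have Y: "Y k = q" "Y (Suc k) = q + a"
    using mult_add_distrib_mat[OF UT dual_carrier Ug] by (simp_all add: Y_eq_dual q_def a_def)
  have D: "U\<^sup>T * (dual (Suc (Suc k)) - qopt) = q + a + b - x"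
  proof -
    have "U\<^sup>T * (dual (Suc (Suc k)) - qopt) = U\<^sup>T * dual (Suc (Suc k)) - x"
      unfolding x_def using UT dual_carrier qopt by (rule mult_minus_distrib_mat)
    also have "U\<^sup>T * dual (Suc (Suc k)) = U\<^sup>T * (dual k + U * grads k) + b"
      unfolding b_def mirror_q.simps using UT Ug dual_carrier
      by (intro mult_add_distrib_mat) (auto intro!: add_carrier_mat)
    also have "U\<^sup>T * (dual k + U * grads k) = q + a"
      unfolding q_def a_def using UT Ug dual_carrier by (intro mult_add_distrib_mat) auto
    finally show ?thesis .
  qed
  have E: "U\<^sup>T * (U * r) = b - a"
    unfolding r_def a_def b_def mult_minus_distrib_mat[OF U_carrier g g]
    by (rule mult_minus_distrib_mat[OF UT Ug Ug])
  show ?thesis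
    unfolding r_def[symmetric] D E
  proof (rule eq_matI)
    fix i m assume "i < dim_row ((- c) \<cdot>\<^sub>m (q + a + b - x + (r - (b - a))))"
      "m < dim_col ((- c) \<cdot>\<^sub>m (q + a + b - x + (r - (b - a))))"
    then have i: "i < n" and m: "m < p" using carr by auto
    have "(X (Suc k) - R) $$ (i, m) = ((- c) \<cdot>\<^sub>m (2 \<cdot>\<^sub>m (q + a) - q + r)) $$ (i, m)"
      unfolding primal_step Y r_def ..
    moreover have "(xopt - R + c \<cdot>\<^sub>m x) $$ (i, m) = 0\<^sub>m n p $$ (i, m)" unfolding x_def kkt ..
    ultimately show "(X (Suc k) - xopt) $$ (i, m)
        = ((- c) \<cdot>\<^sub>m (q + a + b - x + (r - (b - a)))) $$ (i, m)"
      using i m carr R xopt iterate_carrier by (simp add: algebra_simps)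
  qed (use carr xopt iterate_carrier in auto)
qed

lemma mirror_z_error_norm:
  assumes qopt: "qopt \<in> carrier_mat (n - 1) p"
  shows "(mat_norm (mirror_M n (metropolis_laplacian n G) \<beta> c)
      (mirror_z n p U f X k - (qopt @\<^sub>r stacked_gradient n p f xopt)))\<^sup>2
    = lyapunov c U (dual (Suc k) - qopt) (grads k - stacked_gradient n p f xopt)"
proof -
  have A: "grads k - stacked_gradient n p f xopt \<in> carrier_mat n p" by (simp add: minus_carrier_mat)
  have "mirror_z n p U f X k - (qopt @\<^sub>r stacked_gradient n p f xopt)
      = (dual (Suc k) - qopt) @\<^sub>r (grads k - stacked_gradient n p f xopt)"
    unfolding mirror_z_def
    by (rule append_rows_minus[OF dual_carrier qopt stacked_gradient_carrier stacked_gradient_carrier])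
  then show ?thesis
    using mirror_norm_eq_lyapunov[OF U_carrier minus_carrier_mat[OF qopt] A c \<beta>
        factor_frob_contraction[OF G conn factor A], of "\<lambda>i. i" "dual (Suc k)"]
    by (simp add: factor_gram[OF G conn factor])
qed

lemma error_contraction:
  assumes opt: "optimal_allocation n p f R xopt" and qopt: "qopt \<in> carrier_mat (n - 1) p"
    and kkt: "xopt - R + c \<cdot>\<^sub>m (U\<^sup>T * qopt) = 0\<^sub>m n p"
    and f: "\<And>i. i < n \<Longrightarrow> lipschitz_gradient p (lips i) (f i)"
      "\<And>i. i < n \<Longrightarrow> strongly_convex p (mus i) (f i)"
    and mu: "0 < \<mu>" "\<And>i. i < n \<Longrightarrow> \<mu> \<le> mus i"
    and l: "\<And>i. i < n \<Longrightarrow> lips i \<le> l" "\<And>i. i < n \<Longrightarrow> 0 < lips i"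
    and T: "96 * (real n)\<^sup>2 \<le> T" "c * l + 96 * (real n)\<^sup>2 / (c * \<mu>) \<le> 2 * T"
  shows "(1 + T) * lyapunov c U (dual (Suc (Suc k)) - qopt) (grads (Suc k) - stacked_gradient n p f xopt)
    \<le> T * lyapunov c U (dual (Suc k) - qopt) (grads k - stacked_gradient n p f xopt)"
proof -
  define gs where "gs = stacked_gradient n p f xopt"
  have gs: "gs \<in> carrier_mat n p" and g: "grads j \<in> carrier_mat n p" for j by (simp_all add: gs_def)
  have xopt: "xopt \<in> carrier_mat n p"
    using opt by (simp add: optimal_allocation_def is_arg_min_def feasible_def)
  have Ugs: "U * gs = 0\<^sub>m (n - 1) p"
  proof (rule factor_mult_equal_rows[OF G conn factor gs])
    fix i j assume "i < n" "j < n"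
    then show "row gs i = row gs j"
      using optimal_allocation_equal_gradients[OF opt R diff, of i j] xopt diff
      by (simp add: gs_def row_stacked_gradient)
  qed
  define Q where "Q = dual (Suc (Suc k)) - qopt"
  define A where "A = grads (Suc k) - gs"
  define D where "D = grads (Suc k) - grads k"
  define E where "E = X (Suc k) - xopt"
  have carr: "Q \<in> carrier_mat (n - 1) p" "A \<in> carrier_mat n p" "D \<in> carrier_mat n p"
    using qopt gs g by (auto simp: Q_def A_def D_def intro!: minus_carrier_mat)
  have Ug: "U * grads j \<in> carrier_mat (n - 1) p" for j using U_carrier g by simp
  have "U * A = U * grads (Suc k)"
  proof -
    have "M - 0\<^sub>m (n - 1) p = M" if "M \<in> carrier_mat (n - 1) p" for M :: "real mat"
      using that by (intro eq_matI) auto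
    then show ?thesis
      unfolding A_def mult_minus_distrib_mat[OF U_carrier g gs] Ugs using Ug by blast
  qed
  then have Q_prev: "Q - U * A = dual (Suc k) - qopt"
  proof -
    have "P + M - qopt - M = P - qopt"
      if "P \<in> carrier_mat (n - 1) p" "M \<in> carrier_mat (n - 1) p" for P M :: "real mat"
      using that qopt by (intro eq_matI) auto
    from this[OF dual_carrier[of "Suc k"] Ug[of "Suc k"]] show ?thesis
      using \<open>U * A = _\<close> by (simp add: Q_def)
  qed
  have A_prev: "A - D = grads k - gs"
    using gs g[of k] g[of "Suc k"] by (intro eq_matI) (auto simp: A_def D_def)
  have mus_pos: "0 < mus i" if "i < n" for i using mu(1) mu(2)[OF that] by linarith
  have "(1 + T) * lyapunov c U Q A \<le> T * lyapunov c U (Q - U * A) (A - D)"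
  proof (rule lyapunov_contraction[OF U_carrier carr c mu(1)])
    show "0 \<le> 48 * (real n)\<^sup>2" by simp
    show "frob Q Q \<le> 48 * (real n)\<^sup>2 * frob (U\<^sup>T * Q) (U\<^sup>T * Q)"
      by (rule factor_frob_transpose_lower_bound[OF G conn factor carr(1)])
    show "E = (- c) \<cdot>\<^sub>m (U\<^sup>T * Q + (D - U\<^sup>T * (U * D)))"
      unfolding E_def Q_def D_def by (rule error_recursion[OF xopt qopt kkt])
    show "\<mu> * frob E E \<le> frob A E"
      unfolding E_def A_def gs_def
      using iterate_carrier(1) xopt f(2) mu(2) by (rule stacked_gradient_strongly_monotone)
    show "frob A A \<le> l * frob A E"
      unfolding E_def A_def gs_def
      using iterate_carrier(1) xopt f mus_pos l by (rule stacked_gradient_cocoercive)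
    show "2 * (48 * (real n)\<^sup>2) \<le> T" using T(1) by simp
    show "c * l + 2 * (48 * (real n)\<^sup>2) / (c * \<mu>) \<le> 2 * T" using T(2) by simp
  qed (rule factor_frob_contraction[OF G conn factor])
  then show ?thesis unfolding Q_prev A_prev by (simp only: Q_def A_def gs_def)
qed

end

section \<open>Iteration complexity\<close>

text \<open>
  \<open>T / (1 + T) = 1 - 1 / (1 + T) \<le> exp (- 1 / (1 + T))\<close>.
\<close>

lemma geometric_decay_iterations:
  fixes V :: "nat \<Rightarrow> real"
  assumes step: "\<And>k. (1 + T) * V (Suc k) \<le> T * V k" and T: "0 \<le> T" and V0: "0 \<le> V 0"
    and eps: "0 < \<epsilon>" and k: "(1 + T) * ln (inverse \<epsilon>) \<le> real k"
  shows "V k \<le> \<epsilon> * V 0"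
proof -
  define \<rho> where "\<rho> = T / (1 + T)"
  have \<rho>: "0 \<le> \<rho>" using T by (simp add: \<rho>_def)
  have "V j \<le> \<rho> ^ j * V 0" for j
  proof (induction j)
    case (Suc j)
    have "V (Suc j) \<le> \<rho> * V j" using step[of j] T by (simp add: \<rho>_def field_simps)
    also have "\<dots> \<le> \<rho> * (\<rho> ^ j * V 0)" using Suc \<rho> by (rule mult_left_mono)
    finally show ?case by simp
  qed simp
  also have "\<rho> ^ k * V 0 \<le> \<epsilon> * V 0"
  proof (rule mult_right_mono[OF _ V0])
    have "\<rho> = 1 - 1 / (1 + T)" using T by (simp add: \<rho>_def field_simps)
    also have "\<dots> \<le> exp (- (1 / (1 + T)))" using exp_ge_add_one_self[of "- (1 / (1 + T))"] by simp
    finally have "\<rho> ^ k \<le> exp (- (1 / (1 + T))) ^ k" using \<rho> by (rule power_mono)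
    also have "\<dots> = exp (- (real k / (1 + T)))"
      by (simp add: exp_of_nat_mult[symmetric])
    also have "\<dots> \<le> exp (ln \<epsilon>)"
    proof -
      have "ln (inverse \<epsilon>) \<le> real k / (1 + T)" using k T by (simp add: pos_le_divide_eq mult.commute)
      then show ?thesis using eps by (simp only: exp_le_cancel_iff ln_inverse)
    qed
    finally show "\<rho> ^ k \<le> \<epsilon>" using eps by simp
  qed
  finally show ?thesis .
qed

text \<open>
  The first summand uses the upper and the second the lower bound on the step size.
\<close>

lemma step_size_bounds:
  fixes a1 a2 c l \<mu> \<kappa> :: real
  assumes a1: "0 < a1" and mu: "0 < \<mu>" and l: "0 < l" and n: "0 < n"
    and lower: "a1 * real n * \<mu> powr (-0.5) * l powr (-0.5) \<le> c"
    and upper: "c \<le> a2 * real n * \<mu> powr (-0.5) * l powr (-0.5)"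
    and kappa: "\<kappa> = l / \<mu>"
  shows "c * l + 96 * (real n)\<^sup>2 / (c * \<mu>) \<le> (a2 + 96 / a1) * (real n * \<kappa> powr 0.5)"
proof -
  have half: "(0.5 :: real) = 1 / 2" by simp
  have sqrt_kappa: "\<kappa> powr 0.5 = sqrt l / sqrt \<mu>"
    unfolding half kappa using l mu by (simp add: powr_half_sqrt real_sqrt_divide)
  have inv_sqrt: "x powr (-0.5) = 1 / sqrt x" if "0 < x" for x :: real
    unfolding half powr_minus using that by (simp add: powr_half_sqrt inverse_eq_divide)
  define s t where "s = sqrt l" and "t = sqrt \<mu>"
  have st: "0 < s" "0 < t" "l = s\<^sup>2" "\<mu> = t\<^sup>2" using l mu by (auto simp: s_def t_def)
  have c_upper: "c \<le> a2 * real n / (t * s)" and c_lower: "a1 * real n / (t * s) \<le> c"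
    using upper[unfolded inv_sqrt[OF mu] inv_sqrt[OF l]] lower[unfolded inv_sqrt[OF mu] inv_sqrt[OF l]]
    by (simp_all add: s_def t_def)
  have "c * l \<le> a2 * real n / (t * s) * s\<^sup>2"
    unfolding st(3) using c_upper by (rule mult_right_mono) simp
  also have "\<dots> = a2 * (real n * (s / t))"
    using st by (simp add: power2_eq_square field_simps)
  finally have first: "c * l \<le> a2 * (real n * (s / t))" .
  have pos: "0 < a1 * real n / (t * s)" using a1 n st by simp
  have "96 * (real n)\<^sup>2 / (c * \<mu>) \<le> 96 * (real n)\<^sup>2 / (a1 * real n / (t * s) * t\<^sup>2)"
    unfolding st(4) using c_lower pos st
    by (intro divide_left_mono mult_right_mono mult_pos_pos) auto
  also have "\<dots> = 96 / a1 * (real n * (s / t))"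
    using a1 n st by (simp add: power2_eq_square field_simps)
  finally show ?thesis
    using first unfolding sqrt_kappa s_def[symmetric] t_def[symmetric] distrib_right
    by linarith
qed

theorem corollary2:
  fixes a1 a2 :: real
  assumes "0 < a1" and "a1 \<le> a2"
  shows "\<exists>C>0. \<forall>(n::nat) (p::nat) (G::nat pair_pre_digraph) (f::nat \<Rightarrow> real vec \<Rightarrow> real)
      (lips::nat \<Rightarrow> real) (mus::nat \<Rightarrow> real) (lip::real) (mu::real) (\<kappa>::real)
      (R::real mat) (Lap::real mat) (U::real mat) (c::real) (\<beta>::nat \<Rightarrow> real)
      (X::nat \<Rightarrow> real mat) (S::nat \<Rightarrow> real mat) (Y::nat \<Rightarrow> real mat)
      (xopt::real mat) (qopt::real mat) (zopt::real mat).
    pair_graph G \<longrightarrow> pverts G = {..<n} \<longrightarrow> Digraph_Component.connected (with_proj G) \<longrightarrow>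
    (\<forall>i<n. lipschitz_gradient p (lips i) (f i) \<and> 0 < mus i \<and> strongly_convex p (mus i) (f i)) \<longrightarrow>
    mu = Min (mus ` {..<n}) \<longrightarrow> lip = Max (lips ` {..<n}) \<longrightarrow> \<kappa> = lip / mu \<longrightarrow>
    R \<in> carrier_mat n p \<longrightarrow>
    Lap = metropolis_laplacian n G \<longrightarrow> laplacian_factor n Lap U \<longrightarrow>
    0 < c \<longrightarrow>
    a1 * real n * mu powr (-0.5) * lip powr (-0.5) \<le> c \<longrightarrow>
    c \<le> a2 * real n * mu powr (-0.5) * lip powr (-0.5) \<longrightarrow>
    (\<forall>i<n. \<beta> i = c) \<longrightarrow>
    mirror_p_extra n p G Lap f R \<beta> c X S Y \<longrightarrow>
    optimal_allocation n p f R xopt \<longrightarrow>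
    qopt \<in> carrier_mat (n - 1) p \<longrightarrow> xopt - R + c \<cdot>\<^sub>m (U\<^sup>T * qopt) = 0\<^sub>m n p \<longrightarrow>
    zopt = qopt @\<^sub>r stacked_gradient n p f xopt \<longrightarrow>
    (\<forall>\<epsilon>. 0 < \<epsilon> \<longrightarrow> \<epsilon> < 1 \<longrightarrow>
      (\<forall>k::nat. real k \<ge> C * ((real n)\<^sup>2 + real n * \<kappa> powr 0.5) * ln (inverse \<epsilon>) \<longrightarrow>
        (mat_norm (mirror_M n Lap \<beta> c) (mirror_z n p U f X k - zopt))\<^sup>2
          \<le> \<epsilon> * (mat_norm (mirror_M n Lap \<beta> c) (mirror_z n p U f X 0 - zopt))\<^sup>2))"
proof -
  \<comment> \<open>One more than the coefficient of \<open>n\<^sup>2\<close> in \<open>T\<close>, since the error shrinks by \<open>T / (1 + T)\<close>.\<close>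
  define C where "C = 97 + a2 + 96 / a1"
  have C: "0 < C" using assms by (simp add: C_def add_pos_nonneg)
  have "(mat_norm (mirror_M n Lap \<beta> c) (mirror_z n p U f X k - zopt))\<^sup>2
      \<le> \<epsilon> * (mat_norm (mirror_M n Lap \<beta> c) (mirror_z n p U f X 0 - zopt))\<^sup>2"
    if G: "pair_graph G" "pverts G = {..<n}" and conn: "Digraph_Component.connected (with_proj G)"
      and f: "\<forall>i<n. lipschitz_gradient p (lips i) (f i) \<and> 0 < mus i \<and> strongly_convex p (mus i) (f i)"
      and mu: "mu = Min (mus ` {..<n})" and lip: "lip = Max (lips ` {..<n})" and kappa: "\<kappa> = lip / mu"
      and R: "R \<in> carrier_mat n p" and Lap: "Lap = metropolis_laplacian n G"
      and factor: "laplacian_factor n Lap U" and c: "0 < c"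
      and lower: "a1 * real n * mu powr (-0.5) * lip powr (-0.5) \<le> c"
      and upper: "c \<le> a2 * real n * mu powr (-0.5) * lip powr (-0.5)"
      and \<beta>: "\<forall>i<n. \<beta> i = c" and alg: "mirror_p_extra n p G Lap f R \<beta> c X S Y"
      and opt: "optimal_allocation n p f R xopt" and qopt: "qopt \<in> carrier_mat (n - 1) p"
      and kkt: "xopt - R + c \<cdot>\<^sub>m (U\<^sup>T * qopt) = 0\<^sub>m n p"
      and zopt: "zopt = qopt @\<^sub>r stacked_gradient n p f xopt"
      and eps: "0 < \<epsilon>" "\<epsilon> < 1"
      and k: "C * ((real n)\<^sup>2 + real n * \<kappa> powr 0.5) * ln (inverse \<epsilon>) \<le> real k"
    for n p :: nat and G :: "nat pair_pre_digraph" and f :: "nat \<Rightarrow> real vec \<Rightarrow> real"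
      and lips mus :: "nat \<Rightarrow> real" and lip mu \<kappa> :: real and R Lap U :: "real mat" and c :: real
      and \<beta> :: "nat \<Rightarrow> real" and X S Y :: "nat \<Rightarrow> real mat" and xopt qopt zopt :: "real mat"
      and \<epsilon> :: real and k :: nat
  proof -
    note factor = factor[unfolded Lap] and alg = alg[unfolded Lap]
    have diff: "differentiable_vec p (f i)" if "i < n" for i
      using f that by (simp add: strongly_convex_def)
    have \<beta>: "\<beta> i = c" if "i < n" for i using \<beta> that by simp
    have n: "0 < n" using pair_graph_connected(1)[OF G(1) conn] G(2) by auto
    define V where "V j = lyapunov c U
      (mirror_q n p U (\<lambda>t. stacked_gradient n p f (X t)) (Suc j) - qopt)
      (stacked_gradient n p f (X j) - stacked_gradient n p f xopt)" for j
    have norm: "(mat_norm (mirror_M n Lap \<beta> c) (mirror_z n p U f X j - zopt))\<^sup>2 = V j" for j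
      unfolding zopt Lap V_def
      by (rule mirror_z_error_norm[OF G conn factor diff R c \<beta> alg qopt])
    have "V k \<le> \<epsilon> * V 0"
    \<comment> \<open>For \<open>p = 0\<close> all errors vanish, but nothing is known about the sign of \<open>lip\<close>.\<close>
    proof (cases "p = 0")
      case True
      have U: "U \<in> carrier_mat (n - 1) n" by (rule factor_carrier[OF G conn factor])
      have "V j = 0" for j
        using qopt U True by (simp add: V_def lyapunov_def frob_def)
      then show ?thesis by simp
    next
      case False
      then have p: "0 < p" by simp
      have "mu \<in> mus ` {..<n}" unfolding mu using n by (intro Min_in) auto
      then have mu_pos: "0 < mu" using f by auto
      have mu_le: "mu \<le> mus i" and lip_ge: "lips i \<le> lip" if "i < n" for i
        using that by (auto simp: mu lip)
      have lips_pos: "0 < lips i" if "i < n" for i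
        using lipschitz_ge_strong_convexity[OF p] f that by (meson less_le_trans)
      have lip_pos: "0 < lip" using lips_pos[OF n] lip_ge[OF n] by linarith
      define b where "b = real n * \<kappa> powr 0.5"
      have b: "0 \<le> b" by (simp add: b_def)
      define a where "a = a2 + 96 / a1"
      have a: "0 \<le> a" using assms by (simp add: a_def)
      define T where "T = 96 * (real n)\<^sup>2 + a * b"
      have T1: "96 * (real n)\<^sup>2 \<le> T" using a b by (simp add: T_def)
      have T0: "0 \<le> T" using T1 by (rule order_trans[rotated]) simp
      have "c * lip + 96 * (real n)\<^sup>2 / (c * mu) \<le> a * b"
        unfolding a_def b_def
        by (rule step_size_bounds[OF assms(1) mu_pos lip_pos n lower upper kappa])
      also have "a * b \<le> T" by (simp add: T_def)
      also have "T \<le> 2 * T" using T0 by simp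
      finally have T2: "c * lip + 96 * (real n)\<^sup>2 / (c * mu) \<le> 2 * T" .
      have step: "(1 + T) * V (Suc j) \<le> T * V j" for j
        unfolding V_def
        using f by (intro error_contraction[OF G conn factor diff R c \<beta> alg opt qopt kkt
            _ _ mu_pos mu_le lip_ge lips_pos T1 T2]) auto
      have "1 + T \<le> C * ((real n)\<^sup>2 + b)"
      proof -
        have "1 \<le> (real n)\<^sup>2" using n by (simp add: one_le_power)
        moreover have "0 \<le> a * (real n)\<^sup>2" using a by simp
        moreover have "C = 97 + a" by (simp add: C_def a_def)
        then have "C * ((real n)\<^sup>2 + b) = 97 * (real n)\<^sup>2 + a * (real n)\<^sup>2 + 97 * b + a * b"
          by (simp add: algebra_simps)
        ultimately show ?thesis using b unfolding T_def by linarith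
      qed
      then have "(1 + T) * ln (inverse \<epsilon>) \<le> C * ((real n)\<^sup>2 + b) * ln (inverse \<epsilon>)"
        using eps by (intro mult_right_mono) (auto simp: one_le_inverse)
      also have "\<dots> \<le> real k" using k by (simp add: b_def)
      finally have iterations: "(1 + T) * ln (inverse \<epsilon>) \<le> real k" .
      have "0 \<le> V 0" unfolding norm[symmetric] by simp
      from geometric_decay_iterations[OF step T0 this eps(1) iterations] show ?thesis .
    qed
    then show ?thesis by (simp only: norm)
  qed
  note main = this
  show ?thesis
    by (intro exI[of _ C] conjI allI impI C) (rule main; assumption)
qed

end
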